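(* Let $\alpha$ be an ideal of a Noetherian ring $A$ such that the ideal $\alpha[x]$ of $A[x]$ has finitely many maximal collections. Then every maximal collection of $\alpha[x]$ is of the form $M[x]:=[M_i[x]]_i$ for some maximal collection $M=[M_i]_i$ of $\alpha$. In particular, if every ideal of every Noetherian ring has finitely many maximal collections, then for every ideal $\alpha$ of every Noetherian ring, every maximal collection of $\alpha[x]$ is of the form $M[x]$ for some maximal collection $M$ of $\alpha$.
   Context: Rings are commutative with $1$. A collection of an ideal $\alpha$ of a ring $A$ is a finite list $C=[C_1,\dots,C_n]$ of ideals of $A$ with $\prod_i C_i\subseteq\alpha$ but $\prod_{i\ne j}C_i\not\subseteq\alpha$ for all $j$ (an empty product of ideals is $A$); its size is $|C|=n$. For collections $C,C'$ of $\alpha$ with $|C|\le|C'|$, say $C$ lies below $C'$ if $C'$ can be reordered so that $C_i\subseteq C'_i$ for all $i\le |C|$. A maximal collection $M$ of $\alpha$ is a collection such that any collection of $\alpha$ above $M$ is a reordering of $M$. For an ideal $I$ of $A$, $I[x]$ denotes the ideal of $A[x]$ of polynomials with all coefficients in $I$. *)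

theory Defs
  imports "HOL-Algebra.Algebra" "HOL-Library.Multiset"
begin

definition ideals_prod :: "('a, 'm) ring_scheme \<Rightarrow> 'a set list \<Rightarrow> 'a set"
  where "ideals_prod R Is = foldr (ideal_prod R) Is (carrier R)"

text \<open>The list \<open>take j C @ drop (Suc j) C\<close> is \<open>C\<close> with its \<open>j\<close>-th entry removed
  (indices start at 0).\<close>

definition collection :: "('a, 'm) ring_scheme \<Rightarrow> 'a set \<Rightarrow> 'a set list \<Rightarrow> bool"
  where "collection R \<alpha> C \<longleftrightarrow>
    (\<forall>I \<in> set C. ideal I R) \<and>
    ideals_prod R C \<subseteq> \<alpha> \<and>
    (\<forall>j < length C. \<not> ideals_prod R (take j C @ drop (Suc j) C) \<subseteq> \<alpha>)"

definition reordering :: "'b list \<Rightarrow> 'b list \<Rightarrow> bool"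
  where "reordering D C \<longleftrightarrow> mset D = mset C"

definition lies_below :: "'a set list \<Rightarrow> 'a set list \<Rightarrow> bool"
  where "lies_below C C' \<longleftrightarrow>
    length C \<le> length C' \<and>
    (\<exists>D. reordering D C' \<and> (\<forall>i < length C. C ! i \<subseteq> D ! i))"

definition maximal_collection :: "('a, 'm) ring_scheme \<Rightarrow> 'a set \<Rightarrow> 'a set list \<Rightarrow> bool"
  where "maximal_collection R \<alpha> M \<longleftrightarrow>
    collection R \<alpha> M \<and>
    (\<forall>C. collection R \<alpha> C \<and> lies_below M C \<longrightarrow> reordering C M)"

text \<open>Collections are lists, so this set contains every reordering of each of its members.
  As a list has only finitely many reorderings, finiteness of the set does not depend on whether
  collections are counted as lists or up to reordering.\<close>

definition finitely_many_maximal_collections :: "('a, 'm) ring_scheme \<Rightarrow> 'a set \<Rightarrow> bool"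
  where "finitely_many_maximal_collections R \<alpha> \<longleftrightarrow> finite {M. maximal_collection R \<alpha> M}"

definition poly_ideal :: "('a, 'm) ring_scheme \<Rightarrow> 'a set \<Rightarrow> (nat \<Rightarrow> 'a) set"
  where "poly_ideal R I = {p \<in> carrier (UP R). \<forall>n. coeff (UP R) p n \<in> I}"

text \<open>The library locale \<^locale>\<open>noetherian_ring\<close> does not include commutativity.\<close>

definition noetherian_cring :: "('a, 'm) ring_scheme \<Rightarrow> bool"
  where "noetherian_cring R \<longleftrightarrow> cring R \<and> noetherian_ring R"

definition maximal_collections_extended :: "('a, 'm) ring_scheme \<Rightarrow> 'a set \<Rightarrow> bool"
  where "maximal_collections_extended R \<alpha> \<longleftrightarrow>
    (\<forall>N. maximal_collection (UP R) (poly_ideal R \<alpha>) N \<longrightarrow>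
      (\<exists>M. maximal_collection R \<alpha> M \<and> N = map (poly_ideal R) M))"

text \<open>HOL cannot quantify over types inside a formula, so the assumption that every ideal of every
  Noetherian ring has finitely many maximal collections is stated for the rings whose carrier lies
  in a given type \<open>'b\<close>. To conclude something about the rings \<open>A\<close> on a type \<open>'a\<close>, it is assumed for
  \<open>'b = nat \<Rightarrow> 'a\<close>, the type of the polynomials over \<open>A\<close>. This is implied by the assumption for all
  rings, and \<open>nat \<Rightarrow> 'a\<close> also contains a copy of every ring on \<open>'a\<close>.\<close>

definition all_noetherian_finitely_many :: "'b itself \<Rightarrow> bool"
  where "all_noetherian_finitely_many (_ :: 'b itself) \<longleftrightarrow>
    (\<forall>(R :: 'b ring) \<beta>. noetherian_cring R \<and> ideal \<beta> R \<longrightarrow>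
      finitely_many_maximal_collections R \<beta>)"

end

theory Submission
  imports Defs
begin

text \<open>
  For \<open>k > 0\<close> let \<open>\<phi>\<^sub>k\<close> be the endomorphism \<open>x \<mapsto> x^k\<close> of \<open>A[x]\<close>. It maps a collection \<open>N\<close> of \<open>\<alpha>[x]\<close>
  to a collection, namely to the ideals generated by the \<open>\<phi>\<^sub>k(N\<^sub>i)\<close>. In a Noetherian ring the length of the
  collections of a fixed ideal is bounded, so each of them lies below a maximal one. As \<open>\<alpha>[x]\<close> has only
  finitely many maximal collections, one of them, say \<open>L\<close>, satisfies \<open>\<phi>\<^sub>k(N\<^sub>i) \<subseteq> L\<^sub>i\<close> for infinitely many \<open>k\<close>.

  Now let \<open>N\<close> be a longest maximal collection that is not extended from \<open>A\<close>. If \<open>L\<close> is longer than \<open>N\<close>,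
  it is extended, hence \<open>N\<^sub>i \<subseteq> L\<^sub>i\<close>, against the maximality of \<open>N\<close>. Otherwise both have the same length.
  If \<open>g(x) f(x^k) \<in> \<alpha>[x]\<close> for some \<open>k > deg g\<close>, then \<open>\<alpha>\<close> contains all products of a coefficient of \<open>g\<close>
  and a coefficient of \<open>f\<close>. Therefore the \<open>L\<^sub>i\<close> in \<open>\<Prod>\<^sub>i L\<^sub>i \<subseteq> \<alpha>[x]\<close> can be replaced one after the other by
  \<open>c(N\<^sub>i)[x]\<close>, where \<open>c(N\<^sub>i)\<close> is the ideal generated by the coefficients of the elements of \<open>N\<^sub>i\<close>. So the
  \<open>c(N\<^sub>i)[x] \<supseteq> N\<^sub>i\<close> form a collection above \<open>N\<close>, and \<open>N\<close> is a reordering of it.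
\<close>

section \<open>Products of ideals and collections\<close>

lemma ideal_subset_carrier: "ideal I R \<Longrightarrow> I \<subseteq> carrier R"
  by (auto dest: ideal.Icarr)

lemma maximal_collectionD:
  "maximal_collection R \<alpha> M \<Longrightarrow> collection R \<alpha> C \<Longrightarrow> lies_below M C \<Longrightarrow> mset C = mset M"
  by (simp add: maximal_collection_def reordering_def)

lemma ideal_prod_mono:
  assumes "I \<subseteq> I'" "J \<subseteq> J'"
  shows "ideal_prod R I J \<subseteq> ideal_prod R I' J'"
proof
  fix s assume "s \<in> ideal_prod R I J"
  then show "s \<in> ideal_prod R I' J'"
    by induct (use assms in \<open>auto intro: ideal_prod.intros\<close>)
qed

lemma ideal_prod_subset_iff:
  assumes "ideal T R"
  shows "ideal_prod R I J \<subseteq> T \<longleftrightarrow> (\<forall>i\<in>I. \<forall>j\<in>J. i \<otimes>\<^bsub>R\<^esub> j \<in> T)"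
proof (intro iffI subsetI)
  fix s assume T: "\<forall>i\<in>I. \<forall>j\<in>J. i \<otimes>\<^bsub>R\<^esub> j \<in> T" and "s \<in> ideal_prod R I J"
  from this(2) show "s \<in> T"
    by induct (use T assms in \<open>auto intro: additive_subgroup.a_closed ideal.axioms(1)\<close>)
qed (auto intro: ideal_prod.prod)

lemma ideals_prod_Nil [simp]: "ideals_prod R [] = carrier R"
  by (simp add: ideals_prod_def)

lemma ideals_prod_Cons [simp]: "ideals_prod R (I # Is) = ideal_prod R I (ideals_prod R Is)"
  by (simp add: ideals_prod_def)

lemma ideals_prod_mono:
  assumes "list_all2 (\<subseteq>) Is Js"
  shows "ideals_prod R Is \<subseteq> ideals_prod R Js"
  using assms by induct (simp_all add: ideal_prod_mono)

lemma list_remove_nth_mset: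
  assumes "j < length C"
  shows "mset C = add_mset (C ! j) (mset (take j C @ drop (Suc j) C))"
  using assms by (metis id_take_nth_drop mset.simps(2) mset_append union_mset_add_mset_right)

context cring
begin

lemma ideals_prod_ideal:
  "(\<And>I. I \<in> set Is \<Longrightarrow> ideal I R) \<Longrightarrow> ideal (ideals_prod R Is) R"
  by (induct Is) (simp_all add: oneideal ideal_prod_is_ideal)

lemma ideals_prod_append:
  assumes "\<And>I. I \<in> set Is \<union> set Js \<Longrightarrow> ideal I R"
  shows "ideals_prod R (Is @ Js) = ideal_prod R (ideals_prod R Is) (ideals_prod R Js)"
  using assms
proof (induct Is)
  case Nil
  then have "ideal (ideals_prod R Js) R" by (simp add: ideals_prod_ideal)
  then show ?case
    using ideal_prod_one ideal_prod_commute[OF oneideal] by simp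
qed (simp add: ideal_prod_assoc ideals_prod_ideal)

lemma ideals_prod_cong_mset:
  assumes "mset Is = mset Js" "\<And>I. I \<in> set Is \<Longrightarrow> ideal I R"
  shows "ideals_prod R Is = ideals_prod R Js"
  using assms
proof (induct Is arbitrary: Js)
  case (Cons I Is)
  from Cons(2) have "I \<in> set Js" by (metis list.set_intros(1) mset_eq_setD)
  then obtain xs ys where Js: "Js = xs @ I # ys" by (meson split_list)
  have id: "ideal K R" if "K \<in> set (xs @ I # ys)" for K
    using Cons(2,3) that Js by (metis mset_eq_setD)
  have "ideals_prod R Is = ideals_prod R (xs @ ys)"
    using Cons Js by (intro Cons(1)) auto
  also have "\<dots> = ideal_prod R (ideals_prod R xs) (ideals_prod R ys)"
    using id by (intro ideals_prod_append) auto
  finally have "ideals_prod R (I # Is)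
      = ideal_prod R I (ideal_prod R (ideals_prod R xs) (ideals_prod R ys))" by simp
  also have "\<dots> = ideal_prod R (ideals_prod R xs) (ideals_prod R (I # ys))"
    using id ideal_prod_commute[of I "ideals_prod R xs"]
    by (simp add: ideal_prod_assoc[symmetric] ideals_prod_ideal)
  also have "\<dots> = ideals_prod R Js"
    unfolding Js using id by (intro ideals_prod_append[symmetric]) auto
  finally show ?case .
qed simp

lemma ideals_prod_antimono_mset:
  assumes "mset Is \<subseteq># mset Js" "\<And>I. I \<in> set Js \<Longrightarrow> ideal I R"
  shows "ideals_prod R Js \<subseteq> ideals_prod R Is"
proof -
  obtain Ks where Ks: "mset Js = mset (Is @ Ks)"
    using assms(1) by (metis ex_mset mset_append subset_mset.less_eqE)
  then have id: "\<And>I. I \<in> set (Is @ Ks) \<Longrightarrow> ideal I R"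
    using assms(2) by (metis mset_eq_setD)
  have "ideals_prod R Js = ideals_prod R (Is @ Ks)"
    using Ks assms(2) by (rule ideals_prod_cong_mset)
  also have "\<dots> = ideal_prod R (ideals_prod R Is) (ideals_prod R Ks)"
    using id by (intro ideals_prod_append) auto
  also have "\<dots> \<subseteq> ideals_prod R Is"
    using ideal_prod_inter[OF ideals_prod_ideal ideals_prod_ideal, of Is Ks] id by auto
  finally show ?thesis .
qed

text \<open>Dropping further factors only enlarges a product, so testing the removal of single
  entries amounts to testing every proper sub-multiset. This form does not depend on the order of
  the entries.\<close>

lemma collection_iff_mset:
  "collection R \<alpha> C \<longleftrightarrow> (\<forall>I\<in>set C. ideal I R) \<and> ideals_prod R C \<subseteq> \<alpha> \<and>
     (\<forall>D. mset D \<subset># mset C \<longrightarrow> \<not> ideals_prod R D \<subseteq> \<alpha>)" (is "_ \<longleftrightarrow> ?r")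
proof
  assume C: "collection R \<alpha> C"
  have False if D: "mset D \<subset># mset C" "ideals_prod R D \<subseteq> \<alpha>" for D
  proof -
    obtain K where K: "mset C = mset D + K" "K \<noteq> {#}"
      using D(1) by (metis add.right_neutral subset_mset.lessE subset_mset.less_imp_le
          subset_mset.less_irrefl subset_mset.le_iff_add)
    then obtain I where "I \<in># K" by auto
    moreover from this have "I \<in> set C" using K by (metis in_multiset_in_set union_iff)
    then obtain j where j: "j < length C" "C ! j = I" by (metis in_set_conv_nth)
    ultimately have "mset D \<subseteq># mset (take j C @ drop (Suc j) C)"
      using K list_remove_nth_mset[OF j(1)]
      by (metis add_mset_remove_trivial diff_union_single_conv mset_subset_eq_add_left)
    then have "ideals_prod R (take j C @ drop (Suc j) C) \<subseteq> ideals_prod R D"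
      by (rule ideals_prod_antimono_mset)
        (use C in \<open>auto simp: collection_def dest: in_set_takeD in_set_dropD\<close>)
    then show False using C D(2) j(1) unfolding collection_def by blast
  qed
  with C show ?r by (auto simp: collection_def)
next
  assume ?r
  moreover have "mset (take j C @ drop (Suc j) C) \<subset># mset C" if "j < length C" for j
    using list_remove_nth_mset[OF that] by simp
  ultimately show "collection R \<alpha> C"
    unfolding collection_def by blast
qed

lemma collection_cong_mset:
  assumes "mset C = mset D"
  shows "collection R \<alpha> C \<longleftrightarrow> collection R \<alpha> D"
proof -
  have "collection R \<alpha> D" if "collection R \<alpha> C" "mset C = mset D" for C D
    using that ideals_prod_cong_mset[of C D]
    by (auto simp: collection_iff_mset dest: mset_eq_setD)
  with assms show ?thesis by metis
qed

end

section \<open>Collections in Noetherian rings\<close>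

text \<open>The union of a strictly ascending sequence of ideals would be one of its members, which
  the next member contradicts. The larger ideal counts as the smaller element, so induction along
  this relation is Noetherian induction.\<close>

lemma (in noetherian_ring) wf_ideal_psupset: "wf {(J, I). ideal I R \<and> ideal J R \<and> I \<subset> J}"
proof (rule ccontr)
  assume "\<not> ?thesis"
  then obtain f where f: "\<And>i. ideal (f i) R \<and> ideal (f (Suc i)) R \<and> f i \<subset> f (Suc i)"
    unfolding wf_iff_no_infinite_down_chain by blast
  have mono: "f i \<subseteq> f j" if "i \<le> j" for i j
    by (rule lift_Suc_mono_le[OF _ that]) (use f in blast)
  have "f i \<subseteq> f j \<or> f j \<subseteq> f i" for i j
    using mono[of i j] mono[of j i] by (cases "i \<le> j") auto
  moreover have "ideal (f i) R" for i
    using f by blast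
  ultimately have "subset.chain {I. ideal I R} (range f)"
    unfolding subset.chain_def by blast
  then have "\<Union> (range f) \<in> range f"
    by (intro ideal_chain_is_trivial) auto
  then obtain i where "\<Union> (range f) = f i" by auto
  then show False using f[of i] by blast
qed

text \<open>This is the colon ideal \<open>(\<alpha> : S)\<close>. As \<open>S\<close> is any set,
  it serves for a power of one element, for a set of coefficients and for generators of an
  ideal.\<close>

lemma (in cring) colon_ideal:
  assumes "ideal \<alpha> R" "S \<subseteq> carrier R"
  shows "ideal {a \<in> carrier R. \<forall>s\<in>S. s \<otimes> a \<in> \<alpha>} R"
proof -
  interpret \<alpha>: ideal \<alpha> R by fact
  show ?thesis
  proof (intro idealI subgroup.intro)
    fix a assume a: "a \<in> {a \<in> carrier R. \<forall>s\<in>S. s \<otimes> a \<in> \<alpha>}"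
    have "s \<otimes> \<ominus> a \<in> \<alpha>" if "s \<in> S" for s
    proof -
      have "s \<otimes> \<ominus> a = \<ominus> (s \<otimes> a)" using a that assms(2) by (simp add: r_minus subsetD)
      then show ?thesis using a that by simp
    qed
    then show "inv\<^bsub>add_monoid R\<^esub> a \<in> {a \<in> carrier R. \<forall>s\<in>S. s \<otimes> a \<in> \<alpha>}"
      using a by (simp flip: a_inv_def)
    fix x assume x: "x \<in> carrier R"
    have "s \<otimes> (x \<otimes> a) \<in> \<alpha>" "s \<otimes> (a \<otimes> x) \<in> \<alpha>" if "s \<in> S" for s
    proof -
      have "s \<otimes> (x \<otimes> a) = (s \<otimes> a) \<otimes> x" "s \<otimes> (a \<otimes> x) = (s \<otimes> a) \<otimes> x"
        using a x that assms(2) by (auto simp: m_ac subsetD)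
      then show "s \<otimes> (x \<otimes> a) \<in> \<alpha>" "s \<otimes> (a \<otimes> x) \<in> \<alpha>"
        using a x that by (simp_all add: \<alpha>.I_r_closed)
    qed
    then show "x \<otimes> a \<in> {a \<in> carrier R. \<forall>s\<in>S. s \<otimes> a \<in> \<alpha>}"
      "a \<otimes> x \<in> {a \<in> carrier R. \<forall>s\<in>S. s \<otimes> a \<in> \<alpha>}" using a x by auto
  qed (use assms(2) in \<open>auto simp: r_distr subsetD ring_axioms\<close>)
qed

lemma (in cring) add_cgenideal:
  assumes "ideal \<alpha> R" "f \<in> carrier R"
  shows "ideal (\<alpha> <+>\<^bsub>R\<^esub> PIdl f) R" "\<alpha> \<subseteq> \<alpha> <+>\<^bsub>R\<^esub> PIdl f" "f \<in> \<alpha> <+>\<^bsub>R\<^esub> PIdl f"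
proof -
  interpret \<alpha>: ideal \<alpha> R by fact
  interpret F: ideal "PIdl f" R using assms(2) by (rule cgenideal_ideal)
  show "ideal (\<alpha> <+>\<^bsub>R\<^esub> PIdl f) R" by (intro add_ideals assms(1) F.is_ideal)
  have "a = a \<oplus> \<zero>" if "a \<in> \<alpha>" for a using that by simp
  then show "\<alpha> \<subseteq> \<alpha> <+>\<^bsub>R\<^esub> PIdl f" unfolding set_add_def' using F.zero_closed by blast
  have "f = \<zero> \<oplus> f" using assms(2) by simp
  then show "f \<in> \<alpha> <+>\<^bsub>R\<^esub> PIdl f"
    unfolding set_add_def' using \<alpha>.zero_closed cgenideal_self[OF assms(2)] by blast
qed

lemma (in cring) mem_add_cgenidealE:
  assumes "x \<in> \<alpha> <+>\<^bsub>R\<^esub> PIdl f"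
  obtains a r where "a \<in> \<alpha>" "r \<in> carrier R" "x = a \<oplus> r \<otimes> f"
  using assms unfolding set_add_def' cgenideal_def by auto

section \<open>Bounded length of the collections of an ideal\<close>

locale noetherian_comm_ring = cring + noetherian_ring

context noetherian_comm_ring
begin

text \<open>Noetherian induction on \<open>J\<close>. If \<open>N\<close> is not inside
  \<open>J\<close>, some \<open>f\<close> outside \<open>J\<close> has its square in
  \<open>J\<close>; then \<open>K = J + (f)\<close> is strictly larger and
  \<open>K K \<subseteq> J\<close>, so a number \<open>e\<close> for \<open>K\<close> yields
  \<open>2 e\<close> for \<open>J\<close>.\<close>

lemma prod_nilpotent_ideals_subset:
  assumes "ideal J R" "N \<subseteq> carrier R" "\<And>f. f \<in> N \<Longrightarrow> \<exists>n::nat. f [^] n \<in> J"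
  shows "\<exists>e. \<forall>C. (\<forall>I\<in>set C. ideal I R \<and> I \<subseteq> N) \<and> length C = e \<longrightarrow> ideals_prod R C \<subseteq> J"
  using wf_ideal_psupset assms(1,3)
proof (induct J rule: wf_induct_rule)
  case (less J)
  interpret J: ideal J R by (rule less)
  show ?case
  proof (cases "N \<subseteq> J")
    case True
    have "ideals_prod R C \<subseteq> J" if C: "\<forall>I\<in>set C. ideal I R \<and> I \<subseteq> N" "length C = 1" for C
    proof -
      obtain I where "C = [I]" using C(2) by (auto simp: length_Suc_conv)
      then show ?thesis using C(1) True by (auto simp: ideal_prod_one)
    qed
    then show ?thesis by blast
  next
    case False
    then obtain g and n :: nat where g: "g \<in> N" "g \<notin> J" "g [^] n \<in> J" using less(3) by blast
    have "\<exists>f\<in>carrier R. f \<notin> J \<and> f \<otimes> f \<in> J"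
    proof -
      have gc: "g \<in> carrier R" using g assms(2) by blast
      \<comment> \<open>Here \<open>m \<ge> 2\<close>, since \<open>m = 0\<close> would make
        \<open>J\<close> the whole ring and \<open>m = 1\<close> would put \<open>g\<close> into
        \<open>J\<close>. By minimality \<open>g^(m-1)\<close> is outside \<open>J\<close>, and its
        square is a multiple of \<open>g^m\<close> because \<open>2 (m - 1) \<ge> m\<close>.\<close>
      define m where "m = (LEAST m::nat. g [^] m \<in> J)"
      have m: "g [^] m \<in> J" unfolding m_def using g(3) by (rule LeastI)
      have lt: "g [^] k \<notin> J" if "k < m" for k using that not_less_Least unfolding m_def by blast
      have "m \<noteq> 0"
      proof
        assume "m = 0"
        then have "\<one> \<in> J" using m by simp
        then show False using g gc J.one_imp_carrier by blast
      qed
      moreover have "m \<noteq> 1" using m g gc by auto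
      ultimately have m2: "m \<ge> 2" by simp
      then have "g [^] (m - 1) \<notin> J" by (intro lt) simp
      moreover have "g [^] (m - 1) \<otimes> g [^] (m - 1) = g [^] m \<otimes> g [^] (m - 2)"
      proof -
        have "(m - 1) + (m - 1) = m + (m - 2)" using m2 by simp
        then show ?thesis using gc by (simp only: nat_pow_mult)
      qed
      then have "g [^] (m - 1) \<otimes> g [^] (m - 1) \<in> J"
        using m gc by (simp add: J.I_r_closed)
      ultimately show ?thesis using gc by blast
    qed
    then obtain f where f: "f \<in> carrier R" "f \<notin> J" "f \<otimes> f \<in> J" by blast
    let ?K = "J <+>\<^bsub>R\<^esub> PIdl f"
    note K = add_cgenideal[OF less(2) f(1)]
    have "\<exists>e. \<forall>C. (\<forall>I\<in>set C. ideal I R \<and> I \<subseteq> N) \<and> length C = e \<longrightarrow> ideals_prod R C \<subseteq> ?K"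
      using f K less(2,3) by (intro less(1)) blast+
    then obtain e where e: "\<And>C. \<forall>I\<in>set C. ideal I R \<and> I \<subseteq> N \<Longrightarrow> length C = e \<Longrightarrow>
        ideals_prod R C \<subseteq> ?K" by blast
    have KK: "ideal_prod R ?K ?K \<subseteq> J"
    proof (subst ideal_prod_subset_iff[OF less(2)], intro ballI)
      fix x y assume "x \<in> ?K" "y \<in> ?K"
      then obtain a r b s where *: "a \<in> J" "r \<in> carrier R" "x = a \<oplus> r \<otimes> f"
        "b \<in> J" "s \<in> carrier R" "y = b \<oplus> s \<otimes> f" by (auto elim!: mem_add_cgenidealE)
      \<comment> \<open>Every summand has a factor in \<open>J\<close>, namely \<open>a\<close>,
        \<open>b\<close> and \<open>f \<otimes> f\<close> respectively.\<close>
      have "x \<otimes> y = a \<otimes> (b \<oplus> s \<otimes> f) \<oplus> (r \<otimes> f) \<otimes> b \<oplus> (r \<otimes> s) \<otimes> (f \<otimes> f)"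
        using * f J.Icarr by (simp add: r_distr l_distr m_ac a_ac)
      also have "\<dots> \<in> J"
      proof (intro J.a_closed)
        show "a \<otimes> (b \<oplus> s \<otimes> f) \<in> J" using * f(1) J.Icarr by (intro J.I_r_closed) auto
        show "r \<otimes> f \<otimes> b \<in> J" using * f(1) by (intro J.I_l_closed) auto
        show "r \<otimes> s \<otimes> (f \<otimes> f) \<in> J" using * f by (simp add: J.I_l_closed)
      qed
      finally show "x \<otimes> y \<in> J" .
    qed
    have "ideals_prod R C \<subseteq> J" if C: "\<forall>I\<in>set C. ideal I R \<and> I \<subseteq> N" "length C = e + e" for C
    proof -
      have "ideals_prod R C = ideals_prod R (take e C @ drop e C)" by simp
      also have "\<dots> = ideal_prod R (ideals_prod R (take e C)) (ideals_prod R (drop e C))"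
        using C by (intro ideals_prod_append) (auto dest: in_set_takeD in_set_dropD)
      also have "\<dots> \<subseteq> ideal_prod R ?K ?K"
        using C by (intro ideal_prod_mono e) (auto dest: in_set_takeD in_set_dropD)
      finally show ?thesis using KK by blast
    qed
    then show ?thesis by blast
  qed
qed

text \<open>If \<open>f \<in> I\<close> is a nonzerodivisor modulo \<alpha> and \<open>x\<close>
  lies in the product of the remaining ideals, then \<open>f x\<close> lies in \<alpha>, hence so
  does \<open>x\<close>. Thus the ideals of \<open>Is\<close> are cancelled one at a time.\<close>

lemma ideals_prod_cancel_nonzerodivisors:
  assumes "ideal \<alpha> R" "\<And>I. I \<in> set Is \<union> set Js \<Longrightarrow> ideal I R"
    and "\<And>I. I \<in> set Is \<Longrightarrow> \<exists>f\<in>I. \<forall>a\<in>carrier R. f \<otimes> a \<in> \<alpha> \<longrightarrow> a \<in> \<alpha>"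
    and "ideals_prod R (Is @ Js) \<subseteq> \<alpha>"
  shows "ideals_prod R Js \<subseteq> \<alpha>"
  using assms(2-)
proof (induct Is)
  case (Cons I Is)
  have "ideals_prod R (Is @ Js) \<subseteq> \<alpha>"
  proof
    fix x assume x: "x \<in> ideals_prod R (Is @ Js)"
    obtain f where f: "f \<in> I" "\<forall>a\<in>carrier R. f \<otimes> a \<in> \<alpha> \<longrightarrow> a \<in> \<alpha>"
      using Cons(3)[of I] by auto
    have "ideal (ideals_prod R (Is @ Js)) R"
      using Cons(2) by (intro ideals_prod_ideal) auto
    then have "x \<in> carrier R" using x by (rule ideal.Icarr)
    moreover have "f \<otimes> x \<in> \<alpha>"
      using ideal_prod.prod[OF f(1) x, of R] Cons(4) by auto
    ultimately show "x \<in> \<alpha>" using f by blast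
  qed
  then show ?case using Cons(2,3) by (intro Cons(1)) auto
qed simp

text \<open>Noetherian induction as in the existence of primary decompositions: if \<open>f\<close> is a zero divisor
  modulo \<open>\<alpha>\<close> but not nilpotent modulo \<open>\<alpha>\<close>, then \<open>\<alpha>\<close> is the intersection of the larger ideals
  \<open>(\<alpha> : f^N)\<close> and \<open>\<alpha> + (f^N)\<close> for large \<open>N\<close>.\<close>

lemma subproduct_length_bounded:
  assumes "ideal \<alpha> R"
  shows "\<exists>b. \<forall>C. (\<forall>I\<in>set C. ideal I R) \<and> ideals_prod R C \<subseteq> \<alpha> \<longrightarrow>
    (\<exists>D. mset D \<subseteq># mset C \<and> length D \<le> b \<and> ideals_prod R D \<subseteq> \<alpha>)"
  using wf_ideal_psupset assms
proof (induct \<alpha> rule: wf_induct_rule)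
  case (less \<alpha>)
  interpret \<alpha>: ideal \<alpha> R by (rule less)
  show ?case
  proof (cases "\<exists>f\<in>carrier R. (\<forall>n::nat. f [^] n \<notin> \<alpha>) \<and> (\<exists>a\<in>carrier R. f \<otimes> a \<in> \<alpha> \<and> a \<notin> \<alpha>)")
    case True
    then obtain f a where f: "f \<in> carrier R" "\<And>n::nat. f [^] n \<notin> \<alpha>"
      and a: "a \<in> carrier R" "f \<otimes> a \<in> \<alpha>" "a \<notin> \<alpha>" by blast
    define K where "K n = {a \<in> carrier R. f [^] n \<otimes> a \<in> \<alpha>}" for n :: nat
    have K: "ideal (K n) R" for n
      using colon_ideal[OF less(2), of "{f [^] n}"] f by (simp add: K_def)
    have mono: "K n \<subseteq> K (m + n)" for n m
      using f \<alpha>.I_l_closed by (auto simp: K_def m_assoc simp flip: nat_pow_mult)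
    \<comment> \<open>The colon ideals \<open>(\<alpha> : f^n)\<close> have a maximal member; as
      they increase with \<open>n\<close>, they are constant from there on.\<close>
    obtain Z where Z: "Z \<in> range K"
      "\<And>J. (J, Z) \<in> {(J, I). ideal I R \<and> ideal J R \<and> I \<subset> J} \<Longrightarrow> J \<notin> range K"
      by (rule wfE_min[OF wf_ideal_psupset, of "K 0" "range K"]) blast+
    then obtain n where "Z = K n" by blast
    then have n: "\<not> K n \<subset> K m" for m
      using Z(2)[of "K m"] K[of n] K[of m] by auto
    \<comment> \<open>The successor makes \<open>N\<close> positive, which puts \<open>a\<close>
      into \<open>K N\<close> and so makes \<open>K N\<close> strictly larger than \<alpha>.\<close>
    define N where "N = Suc n"
    have KN: "K (N + N) = K N"
      using mono[of n 1] mono[of n "N + 1"] n[of N] n[of "N + N"] by (simp add: N_def psubset_eq)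
    have "f [^] N \<in> carrier R" using f by simp
    note G = add_cgenideal[OF less(2) this]
    let ?G = "\<alpha> <+>\<^bsub>R\<^esub> PIdl (f [^] N)"
    have "\<alpha> \<subset> ?G" using G f by blast
    then obtain b1 where b1: "\<And>C. (\<forall>I\<in>set C. ideal I R) \<and> ideals_prod R C \<subseteq> ?G \<Longrightarrow>
        \<exists>D. mset D \<subseteq># mset C \<and> length D \<le> b1 \<and> ideals_prod R D \<subseteq> ?G"
      using less(1)[of ?G] less(2) G(1) by auto
    have "f [^] N \<otimes> a = f [^] n \<otimes> (f \<otimes> a)"
      using f a by (simp add: N_def m_assoc)
    then have "a \<in> K N" using f a by (simp add: K_def \<alpha>.I_l_closed)
    moreover have "\<alpha> \<subseteq> K N" using f by (auto simp: K_def \<alpha>.I_l_closed \<alpha>.Icarr)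
    ultimately have "\<alpha> \<subset> K N" using a by blast
    then obtain b2 where b2: "\<And>C. (\<forall>I\<in>set C. ideal I R) \<and> ideals_prod R C \<subseteq> K N \<Longrightarrow>
        \<exists>D. mset D \<subseteq># mset C \<and> length D \<le> b2 \<and> ideals_prod R D \<subseteq> K N"
      using less(1)[of "K N"] less(2) K by auto
    have inter: "x \<in> \<alpha>" if x: "x \<in> ?G" "x \<in> K N" for x
    proof -
      obtain c r where c: "c \<in> \<alpha>" "r \<in> carrier R" "x = c \<oplus> r \<otimes> f [^] N"
        using x(1) by (rule mem_add_cgenidealE)
      \<comment> \<open>Multiplying \<open>x = c + r f^N\<close> by \<open>f^N\<close> shows that
        \<open>f^(2N) r\<close> lies in \<alpha>. By stability \<open>f^N r\<close> already lies in
        \<alpha>, and with it \<open>x\<close>.\<close>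
      have "f [^] (N + N) \<otimes> r = f [^] N \<otimes> x \<ominus> f [^] N \<otimes> c"
        using c f \<alpha>.Icarr by (simp add: r_distr m_ac a_ac minus_eq r_neg2 flip: nat_pow_mult)
      also have "\<dots> \<in> \<alpha>"
        using c x(2) f unfolding minus_eq by (intro \<alpha>.a_closed \<alpha>.a_inv_closed) (auto simp: K_def \<alpha>.I_l_closed)
      finally have "r \<in> K (N + N)" using c by (simp add: K_def)
      then have "f [^] N \<otimes> r \<in> \<alpha>" unfolding KN by (simp add: K_def)
      then show ?thesis using c f by (simp add: m_comm)
    qed
    have "\<exists>D. mset D \<subseteq># mset C \<and> length D \<le> b1 + b2 \<and> ideals_prod R D \<subseteq> \<alpha>"
      if C: "\<forall>I\<in>set C. ideal I R" "ideals_prod R C \<subseteq> \<alpha>" for C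
    proof -
      obtain D1 where D1: "mset D1 \<subseteq># mset C" "length D1 \<le> b1" "ideals_prod R D1 \<subseteq> ?G"
        using b1[of C] C \<open>\<alpha> \<subset> ?G\<close> by blast
      obtain D2 where D2: "mset D2 \<subseteq># mset C" "length D2 \<le> b2" "ideals_prod R D2 \<subseteq> K N"
        using b2[of C] C \<open>\<alpha> \<subset> K N\<close> by blast
      \<comment> \<open>The multiset union takes the larger multiplicity, so \<open>D\<close> stays
        inside \<open>C\<close>, which the sum of \<open>D1\<close> and \<open>D2\<close> need not.
        Its product lies in those of \<open>D1\<close> and \<open>D2\<close>, hence in both larger
        ideals and so in \<alpha>.\<close>
      obtain D where D: "mset D = mset D1 \<union># mset D2" using ex_mset[of "mset D1 \<union># mset D2"] by metis
      have sub: "mset D \<subseteq># mset C" unfolding D using D1 D2 by simp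
      have "size (mset D) \<le> size (mset D1 + mset D2)"
        unfolding D by (intro size_mset_mono) simp
      then have len: "length D \<le> b1 + b2" using D1 D2 by simp
      have id: "I \<in> set D \<Longrightarrow> ideal I R" for I
        using sub C by (metis mset_subset_eqD set_mset_mset)
      have "ideals_prod R D \<subseteq> ideals_prod R D1" "ideals_prod R D \<subseteq> ideals_prod R D2"
        by (rule ideals_prod_antimono_mset; simp add: D id)+
      then have "ideals_prod R D \<subseteq> \<alpha>" using inter D1 D2 by blast
      then show ?thesis using sub len by blast
    qed
    then show ?thesis by blast
  next
    case primary: False
    \<comment> \<open>Every element outside the radical \<open>N\<close> of \<alpha> is now a
      nonzerodivisor modulo \<alpha>. Either at least \<open>e\<close> factors lie inside
      \<open>N\<close> and any \<open>e\<close> of them suffice, or the factors not inside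
      \<open>N\<close> are cancelled and fewer than \<open>e\<close> remain.\<close>
    define N where "N = {f \<in> carrier R. \<exists>n::nat. f [^] n \<in> \<alpha>}"
    obtain e where e: "\<And>C. (\<forall>I\<in>set C. ideal I R \<and> I \<subseteq> N) \<and> length C = e \<Longrightarrow> ideals_prod R C \<subseteq> \<alpha>"
      using prod_nilpotent_ideals_subset[OF less(2), of N] unfolding N_def by blast
    have "\<exists>D. mset D \<subseteq># mset C \<and> length D \<le> e \<and> ideals_prod R D \<subseteq> \<alpha>"
      if C: "\<forall>I\<in>set C. ideal I R" "ideals_prod R C \<subseteq> \<alpha>" for C
    proof -
      define C1 where "C1 = filter (\<lambda>I. I \<subseteq> N) C"
      define C2 where "C2 = filter (\<lambda>I. \<not> I \<subseteq> N) C"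
      have mC: "mset C = mset (C2 @ C1)"
        by (simp add: C1_def C2_def)
      show ?thesis
      proof (cases "length C1 \<ge> e")
        case True
        have "mset C1 = mset (take e C1) + mset (drop e C1)"
          by (simp flip: mset_append)
        then have "mset (take e C1) \<subseteq># mset C"
          using mC by simp
        moreover have "ideals_prod R (take e C1) \<subseteq> \<alpha>"
          using True C by (intro e) (auto simp: C1_def dest!: in_set_takeD)
        ultimately show ?thesis by (intro exI[of _ "take e C1"]) simp
      next
        case False
        have "ideals_prod R (C2 @ C1) \<subseteq> \<alpha>"
          using C ideals_prod_cong_mset[OF mC] by simp
        moreover have "\<exists>f\<in>I. \<forall>a\<in>carrier R. f \<otimes> a \<in> \<alpha> \<longrightarrow> a \<in> \<alpha>" if "I \<in> set C2" for I
        proof -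
          have "ideal I R" "\<not> I \<subseteq> N" using that C by (auto simp: C2_def)
          then obtain f where f: "f \<in> I" "f \<notin> N" by blast
          then have "f \<in> carrier R" using \<open>ideal I R\<close> by (auto dest: ideal.Icarr)
          then show ?thesis
            using f primary unfolding N_def by blast
        qed
        ultimately have "ideals_prod R C1 \<subseteq> \<alpha>"
          using C by (intro ideals_prod_cancel_nonzerodivisors[OF less(2), of C2 C1])
            (auto simp: C1_def C2_def)
        then show ?thesis using False mC by (intro exI[of _ C1]) simp
      qed
    qed
    then show ?thesis by blast
  qed
qed

text \<open>A collection has no proper subproduct inside \<alpha>, so the short subproduct from
  \<open>subproduct_length_bounded\<close> is the whole collection.\<close>

lemma collection_length_bounded:
  assumes "ideal \<alpha> R"
  shows "\<exists>b. \<forall>C. collection R \<alpha> C \<longrightarrow> length C \<le> b"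
proof -
  obtain b where b: "\<And>C. (\<forall>I\<in>set C. ideal I R) \<and> ideals_prod R C \<subseteq> \<alpha> \<Longrightarrow>
      \<exists>D. mset D \<subseteq># mset C \<and> length D \<le> b \<and> ideals_prod R D \<subseteq> \<alpha>"
    using subproduct_length_bounded[OF assms] by blast
  have "length C \<le> b" if C: "collection R \<alpha> C" for C
  proof -
    obtain D where D: "mset D \<subseteq># mset C" "length D \<le> b" "ideals_prod R D \<subseteq> \<alpha>"
      using b[of C] C unfolding collection_iff_mset by blast
    then have "mset D = mset C"
      using C unfolding collection_iff_mset by (metis subset_mset.le_neq_trans)
    then show ?thesis using D(2) by (metis size_mset)
  qed
  then show ?thesis by blast
qed

text \<open>Among the collections entrywise above \<open>C\<close>, one first maximises the length,
  which is bounded, and then the entries lexicographically. A collection above the result is, once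
  reordered, entrywise above it, hence equally long; a first differing entry would be strictly
  larger, against the lexicographic choice.\<close>

lemma maximal_collection_above:
  assumes "ideal \<alpha> R" "collection R \<alpha> C"
  obtains M where "maximal_collection R \<alpha> M" "length C \<le> length M"
    "\<And>i. i < length C \<Longrightarrow> C ! i \<subseteq> M ! i"
proof -
  define above :: "'a set list \<Rightarrow> 'a set list \<Rightarrow> bool" where
    "above D E \<longleftrightarrow> length D \<le> length E \<and> (\<forall>i < length D. D ! i \<subseteq> E ! i)" for D E
  have trans: "above D F" if "above D E" "above E F" for D E F
    using that unfolding above_def by (meson less_le_trans order_trans)
  obtain b where b: "\<And>C. collection R \<alpha> C \<Longrightarrow> length C \<le> b"
    using collection_length_bounded[OF assms(1)] by blast
  have "\<exists>D. (collection R \<alpha> D \<and> above C D) \<and>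
      (\<forall>E. collection R \<alpha> E \<and> above C E \<longrightarrow> length E \<le> length D)"
    using assms(2) b by (intro ex_has_greatest_nat[of _ C _ "Suc b"]) (auto simp: above_def le_imp_less_Suc)
  then obtain D0 where D0: "collection R \<alpha> D0" "above C D0"
    and max: "\<And>E. collection R \<alpha> E \<Longrightarrow> above C E \<Longrightarrow> length E \<le> length D0" by blast
  define r where "r = {(J, I). ideal I R \<and> ideal J R \<and> I \<subset> J}"
  \<comment> \<open>\<open>lex\<close> compares lists of equal length at their first difference, and
    \<open>r\<close> ranks larger ideals lower; a minimal list is thus lexicographically as large as
    possible.\<close>
  have "wf (lex r)" unfolding r_def by (intro wf_lex wf_ideal_psupset)
  define Q where "Q = {D. collection R \<alpha> D \<and> above C D \<and> length D = length D0}"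
  have "D0 \<in> Q" using D0 by (simp add: Q_def)
  then obtain M where M: "M \<in> Q" and min: "\<And>E. (E, M) \<in> lex r \<Longrightarrow> E \<notin> Q"
    using wfE_min[OF \<open>wf (lex r)\<close>] by metis
  have "reordering E M" if E: "collection R \<alpha> E" "lies_below M E" for E
  proof -
    obtain E' where E': "mset E' = mset E" "above M E'"
      using E(2) unfolding lies_below_def reordering_def above_def by (metis size_mset)
    have colE': "collection R \<alpha> E'" using E(1) collection_cong_mset[OF E'(1)] by simp
    have "above C E'" using M E'(2) trans by (auto simp: Q_def)
    moreover have "length E' = length D0"
      using max[OF colE' calculation] E'(2) M by (simp add: Q_def above_def)
    ultimately have "E' \<in> Q" using colE' by (simp add: Q_def)
    have "E' = M"
    proof (rule ccontr)
      assume "E' \<noteq> M"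
      have len: "length E' = length M" using \<open>E' \<in> Q\<close> M by (simp add: Q_def)
      define i where "i = (LEAST i. i < length M \<and> E' ! i \<noteq> M ! i)"
      have "\<exists>i. i < length M \<and> E' ! i \<noteq> M ! i" using len \<open>E' \<noteq> M\<close> nth_equalityI by metis
      then have i: "i < length M \<and> E' ! i \<noteq> M ! i" unfolding i_def by (rule LeastI_ex)
      have before: "E' ! j = M ! j" if "j < i" for j
        using not_less_Least[OF that[unfolded i_def]] that i by auto
      have "take i E' = take i M" using before i len by (intro nth_equalityI) auto
      moreover have "(E' ! i, M ! i) \<in> r"
        using i len E'(2) M colE' unfolding r_def above_def Q_def collection_def by auto
      moreover have "E' = take i E' @ E' ! i # drop (Suc i) E'" "M = take i M @ M ! i # drop (Suc i) M"
        using i len by (simp_all add: id_take_nth_drop)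
      ultimately have "(E', M) \<in> lex r"
        unfolding lex_conv using len by (smt (verit) mem_Collect_eq case_prodI)
      then show False using min \<open>E' \<in> Q\<close> by blast
    qed
    then show ?thesis using E'(1) by (simp add: reordering_def)
  qed
  then have "maximal_collection R \<alpha> M"
    using M by (simp add: maximal_collection_def Q_def)
  moreover have "above C M" using M by (simp add: Q_def)
  ultimately show thesis using that by (simp add: above_def)
qed

end

section \<open>Ideals of polynomial rings\<close>

lemma (in additive_subgroup) finsum_mem:
  assumes "abelian_monoid G" "\<And>i. i \<in> S \<Longrightarrow> f i \<in> H"
  shows "finsum G f S \<in> H"
proof -
  interpret abelian_monoid G by fact
  show ?thesis
  proof (cases "finite S")
    case True
    then show ?thesis using assms(2)
    proof (induct S)
      case (insert i S)
      then have "finsum G f (insert i S) = f i \<oplus>\<^bsub>G\<^esub> finsum G f S"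
        by (intro finsum_insert) auto
      then show ?case using insert by simp
    qed simp
  qed (simp add: finsum_infinite)
qed

text \<open>Two colon ideals in turn: the generators \<open>T\<close> lie in \<open>(U : S)\<close>,
  hence so does \<open>Idl T\<close>; therefore \<open>S\<close>, and with it \<open>Idl S\<close>,
  lies in \<open>(U : Idl T)\<close>.\<close>

lemma (in cring) prod_genideal_subset:
  assumes "ideal U R" "S \<subseteq> carrier R" "T \<subseteq> carrier R"
    and "\<And>s t. s \<in> S \<Longrightarrow> t \<in> T \<Longrightarrow> s \<otimes> t \<in> U"
  shows "ideal_prod R (Idl S) (Idl T) \<subseteq> U"
proof -
  have "Idl T \<subseteq> {a \<in> carrier R. \<forall>s\<in>S. s \<otimes> a \<in> U}"
    using assms by (intro genideal_minimal colon_ideal) auto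
  moreover have "Idl T \<subseteq> carrier R"
    using assms(3) genideal_minimal oneideal by blast
  ultimately have "Idl S \<subseteq> {a \<in> carrier R. \<forall>t\<in>Idl T. t \<otimes> a \<in> U}"
    using assms by (intro genideal_minimal colon_ideal) (auto simp: m_comm subset_iff oneideal)
  then show ?thesis
    using \<open>Idl T \<subseteq> carrier R\<close>
    by (subst ideal_prod_subset_iff[OF assms(1)]) (auto simp: m_comm subset_iff)
qed

text \<open>This is the ideal \<open>c(N)\<close> of the overview. On sets of polynomials it is left
  adjoint to the extension of ideals, see \<open>poly_content_subset_iff\<close>.\<close>

definition poly_content :: "('a, 'm) ring_scheme \<Rightarrow> (nat \<Rightarrow> 'a) set \<Rightarrow> 'a set"
  where "poly_content R N = genideal R {up_ring.coeff (UP R) p n | p n. p \<in> N}"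

text \<open>\<open>poly_stretch R k p\<close> is the polynomial \<open>p(x^k)\<close>.\<close>

definition poly_stretch :: "('a, 'm) ring_scheme \<Rightarrow> nat \<Rightarrow> (nat \<Rightarrow> 'a) \<Rightarrow> nat \<Rightarrow> 'a"
  where "poly_stretch R k p n = (if k dvd n then p (n div k) else \<zero>\<^bsub>R\<^esub>)"

context UP_cring
begin

lemma mem_poly_ideal: "p \<in> poly_ideal R I \<longleftrightarrow> p \<in> carrier P \<and> (\<forall>n. up_ring.coeff P p n \<in> I)"
  by (simp add: poly_ideal_def P_def)

lemma poly_ideal_ideal:
  assumes "ideal I R"
  shows "ideal (poly_ideal R I) P"
proof -
  interpret I: ideal I R by fact
  have mult: "x \<otimes>\<^bsub>P\<^esub> a \<in> poly_ideal R I" if "a \<in> poly_ideal R I" "x \<in> carrier P" for a x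
  proof -
    have "(\<Oplus>i\<in>{..n}. up_ring.coeff P x i \<otimes> up_ring.coeff P a (n - i)) \<in> I" for n
      using that by (intro I.finsum_mem R.abelian_monoid_axioms I.I_l_closed) (auto simp: mem_poly_ideal)
    then show ?thesis using that by (simp add: mem_poly_ideal)
  qed
  show ?thesis
  proof (intro idealI subgroup.intro)
    show "inv\<^bsub>add_monoid P\<^esub> x \<in> poly_ideal R I" if "x \<in> poly_ideal R I" for x
      using that by (simp add: mem_poly_ideal flip: a_inv_def)
    show "a \<otimes>\<^bsub>P\<^esub> x \<in> poly_ideal R I" if "a \<in> poly_ideal R I" "x \<in> carrier P" for a x
      using mult[OF that] that by (simp add: P.m_comm mem_poly_ideal)
  qed (use mult in \<open>auto simp: mem_poly_ideal P.ring_axioms\<close>)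
qed

lemma monom_mem_poly_ideal:
  assumes "ideal I R" "a \<in> carrier R"
  shows "up_ring.monom P a n \<in> poly_ideal R I \<longleftrightarrow> a \<in> I"
  using assms additive_subgroup.zero_closed[OF ideal.axioms(1)[OF assms(1)]]
  by (auto simp: mem_poly_ideal)

lemma poly_ideal_mono: "I \<subseteq> J \<Longrightarrow> poly_ideal R I \<subseteq> poly_ideal R J"
  unfolding poly_ideal_def by blast

lemma poly_ideal_subset_iff:
  assumes "ideal I R" "ideal J R"
  shows "poly_ideal R I \<subseteq> poly_ideal R J \<longleftrightarrow> I \<subseteq> J"
proof
  assume "poly_ideal R I \<subseteq> poly_ideal R J"
  then show "I \<subseteq> J"
    using monom_mem_poly_ideal[OF assms(1)] monom_mem_poly_ideal[OF assms(2)] ideal.Icarr[OF assms(1)]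
    by blast
qed (rule poly_ideal_mono)

lemma mem_ideal_if_monoms:
  assumes "ideal T P" "p \<in> carrier P" "\<And>n. up_ring.monom P (up_ring.coeff P p n) n \<in> T"
  shows "p \<in> T"
proof -
  have "(\<Oplus>\<^bsub>P\<^esub> i \<in> {..deg R p}. up_ring.monom P (up_ring.coeff P p i) i) \<in> T"
    by (rule additive_subgroup.finsum_mem[OF ideal.axioms(1)[OF assms(1)] P.abelian_monoid_axioms assms(3)])
  then show ?thesis by (simp only: up_repr[OF assms(2)])
qed

lemma poly_ideal_carrier: "poly_ideal R (carrier R) = carrier P"
  by (auto simp: mem_poly_ideal)

text \<open>One inclusion is the convolution formula for coefficients. For the other, it is enough
  to treat monomials, and \<open>i j x^n\<close> is the product of the constant \<open>i\<close> and
  \<open>j x^n\<close>.\<close>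

lemma poly_ideal_prod:
  assumes "ideal I R" "ideal J R"
  shows "poly_ideal R (ideal_prod R I J) = ideal_prod P (poly_ideal R I) (poly_ideal R J)"
proof
  have IJ: "ideal (ideal_prod R I J) R" using assms by (rule R.ideal_prod_is_ideal)
  interpret IJ: ideal "ideal_prod R I J" R by (rule IJ)
  show "ideal_prod P (poly_ideal R I) (poly_ideal R J) \<subseteq> poly_ideal R (ideal_prod R I J)"
  proof (subst ideal_prod_subset_iff[OF poly_ideal_ideal[OF IJ]], intro ballI)
    fix p q assume "p \<in> poly_ideal R I" "q \<in> poly_ideal R J"
    then show "p \<otimes>\<^bsub>P\<^esub> q \<in> poly_ideal R (ideal_prod R I J)"
      by (auto simp: mem_poly_ideal intro!: IJ.finsum_mem R.abelian_monoid_axioms ideal_prod.prod)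
  qed
  let ?T = "ideal_prod P (poly_ideal R I) (poly_ideal R J)"
  have T: "ideal ?T P" by (intro P.ideal_prod_is_ideal poly_ideal_ideal assms)
  have "a \<in> carrier R \<and> up_ring.monom P a n \<in> ?T" if "a \<in> ideal_prod R I J" for a n
    using that
  proof induct
    case (prod i j)
    then have "i \<in> carrier R" "j \<in> carrier R" using assms by (auto dest: ideal.Icarr)
    then have "up_ring.monom P (i \<otimes> j) n = up_ring.monom P i 0 \<otimes>\<^bsub>P\<^esub> up_ring.monom P j n"
      using monom_mult[of i j 0 n] by simp
    then show ?case
      using prod assms \<open>i \<in> carrier R\<close> \<open>j \<in> carrier R\<close>
      by (auto intro!: ideal_prod.prod simp: monom_mem_poly_ideal)
  qed (auto intro: ideal_prod.sum)
  then show "poly_ideal R (ideal_prod R I J) \<subseteq> ?T"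
    using mem_ideal_if_monoms[OF T] by (meson mem_poly_ideal subsetI)
qed

lemma poly_ideal_ideals_prod:
  assumes "\<And>I. I \<in> set Is \<Longrightarrow> ideal I R"
  shows "ideals_prod P (map (poly_ideal R) Is) = poly_ideal R (ideals_prod R Is)"
  using assms by (induct Is) (simp_all add: poly_ideal_carrier poly_ideal_prod R.ideals_prod_ideal)

text \<open>Extension commutes with products of ideals and reflects inclusions, so each inclusion in
  the definition of a collection holds for the extended list exactly when it holds for
  \<open>C\<close>.\<close>

lemma collection_poly_ideal_iff:
  assumes "ideal \<alpha> R" "\<And>I. I \<in> set C \<Longrightarrow> ideal I R"
  shows "collection P (poly_ideal R \<alpha>) (map (poly_ideal R) C) \<longleftrightarrow> collection R \<alpha> C"
proof -
  have iff: "ideals_prod P (map (poly_ideal R) D) \<subseteq> poly_ideal R \<alpha> \<longleftrightarrow> ideals_prod R D \<subseteq> \<alpha>"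
    if "set D \<subseteq> set C" for D
  proof -
    have D: "ideal I R" if "I \<in> set D" for I using assms(2) that \<open>set D \<subseteq> set C\<close> by auto
    show ?thesis
      by (simp add: poly_ideal_ideals_prod poly_ideal_subset_iff assms(1) D R.ideals_prod_ideal)
  qed
  have "ideals_prod P (take j (map (poly_ideal R) C) @ drop (Suc j) (map (poly_ideal R) C))
      \<subseteq> poly_ideal R \<alpha> \<longleftrightarrow> ideals_prod R (take j C @ drop (Suc j) C) \<subseteq> \<alpha>" for j
    using iff[of "take j C @ drop (Suc j) C"] set_take_subset[of j C] set_drop_subset[of "Suc j" C]
    by (simp add: take_map drop_map)
  then show ?thesis
    using iff[of C] assms(2) by (auto simp: collection_def poly_ideal_ideal)
qed

lemma poly_content_ideal: "N \<subseteq> carrier P \<Longrightarrow> ideal (poly_content R N) R"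
  unfolding poly_content_def by (intro R.genideal_ideal) (auto simp flip: P_def)

lemma subset_poly_ideal_content: "N \<subseteq> carrier P \<Longrightarrow> N \<subseteq> poly_ideal R (poly_content R N)"
proof
  fix p assume N: "N \<subseteq> carrier P" and p: "p \<in> N"
  have "{up_ring.coeff P p n | p n. p \<in> N} \<subseteq> poly_content R N"
    unfolding poly_content_def P_def[symmetric] using N by (intro R.genideal_self) auto
  then show "p \<in> poly_ideal R (poly_content R N)"
    using N p by (auto simp: mem_poly_ideal)
qed

lemma poly_content_subset_iff:
  assumes "N \<subseteq> carrier P" "ideal J R"
  shows "poly_content R N \<subseteq> J \<longleftrightarrow> N \<subseteq> poly_ideal R J"
proof
  assume "N \<subseteq> poly_ideal R J"
  then show "poly_content R N \<subseteq> J"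
    unfolding poly_content_def P_def[symmetric]
    by (intro R.genideal_minimal assms) (auto simp: mem_poly_ideal)
next
  assume "poly_content R N \<subseteq> J"
  then show "N \<subseteq> poly_ideal R J"
    using subset_poly_ideal_content[OF assms(1)] poly_ideal_mono by blast
qed

text \<open>This left inverse of extension later recovers a multiset of ideals from the multiset of
  their extensions.\<close>

lemma poly_content_poly_ideal:
  assumes "ideal J R"
  shows "poly_content R (poly_ideal R J) = J"
proof
  have sub: "poly_ideal R J \<subseteq> carrier P" by (auto simp: mem_poly_ideal)
  show "poly_content R (poly_ideal R J) \<subseteq> J"
    by (simp add: poly_content_subset_iff sub assms)
  show "J \<subseteq> poly_content R (poly_ideal R J)"
    using subset_poly_ideal_content[OF sub]
    by (simp add: poly_ideal_subset_iff assms poly_content_ideal sub)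
qed

section \<open>The substitution \<open>x \<mapsto> x^k\<close>\<close>

lemma carrier_P: "carrier P = up R"
  by (simp add: P_def UP_def)

lemma poly_stretch_closed:
  assumes "0 < k" "p \<in> carrier P"
  shows "poly_stretch R k p \<in> carrier P"
proof -
  have p: "p \<in> up R" using assms(2) by (simp only: carrier_P)
  then obtain n where n: "bound \<zero> n p" by auto
  \<comment> \<open>The extra \<open>k\<close> ensures \<open>m div k > n\<close> for every
    \<open>m\<close> beyond the bound, whether or not \<open>k\<close> divides
    \<open>m\<close>.\<close>
  have "bound \<zero> (n * k + k) (poly_stretch R k p)"
  proof
    fix m assume m: "n * k + k < m"
    then have "Suc n \<le> m div k" using assms(1) by (subst less_eq_div_iff_mult_less_eq) auto
    then show "poly_stretch R k p m = \<zero>" using n by (auto simp: poly_stretch_def bound_def)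
  qed
  then have "poly_stretch R k p \<in> up R"
    using p by (intro mem_upI) (auto simp: poly_stretch_def)
  then show ?thesis by (simp only: carrier_P)
qed

text \<open>\<open>UP R\<close> represents polynomials as functions, and its \<open>coeff\<close> is
  the identity restricted to \<open>up R\<close>; hence the carrier hypothesis.\<close>

lemma coeff_P: "p \<in> carrier P \<Longrightarrow> up_ring.coeff P p n = p n"
  unfolding carrier_P unfolding P_def UP_def up_ring.select_convs by (simp only: restrict_apply')

lemma coeff_poly_stretch:
  assumes "0 < k" "p \<in> carrier P"
  shows "up_ring.coeff P (poly_stretch R k p) n = (if k dvd n then up_ring.coeff P p (n div k) else \<zero>)"
  using assms poly_stretch_closed[OF assms] by (simp only: coeff_P poly_stretch_def)

lemma poly_stretch_add:
  assumes "0 < k" "p \<in> carrier P" "q \<in> carrier P"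
  shows "poly_stretch R k (p \<oplus>\<^bsub>P\<^esub> q) = poly_stretch R k p \<oplus>\<^bsub>P\<^esub> poly_stretch R k q"
  by (rule up_eqI) (use assms in \<open>auto simp: coeff_poly_stretch poly_stretch_closed\<close>)

lemma poly_stretch_one:
  assumes "0 < k"
  shows "poly_stretch R k \<one>\<^bsub>P\<^esub> = \<one>\<^bsub>P\<^esub>"
  by (rule up_eqI) (use assms in \<open>auto simp: coeff_poly_stretch poly_stretch_closed dvd_div_eq_0_iff\<close>)

text \<open>A term of the convolution can be nonzero only if \<open>k\<close> divides both
  \<open>i\<close> and \<open>n - i\<close>. If \<open>k\<close> divides \<open>n\<close>, the sum
  reindexes along \<open>i = k j\<close>; otherwise every term vanishes.\<close>

lemma poly_stretch_mult:
  assumes k: "0 < k" and p: "p \<in> carrier P" and q: "q \<in> carrier P"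
  shows "poly_stretch R k (p \<otimes>\<^bsub>P\<^esub> q) = poly_stretch R k p \<otimes>\<^bsub>P\<^esub> poly_stretch R k q"
proof (rule up_eqI)
  fix n
  let ?f = "\<lambda>i. up_ring.coeff P (poly_stretch R k p) i \<otimes> up_ring.coeff P (poly_stretch R k q) (n - i)"
  have cl: "?f i \<in> carrier R" for i using assms by (simp add: poly_stretch_closed)
  have "(\<Oplus>i\<in>{..n}. ?f i) = up_ring.coeff P (poly_stretch R k (p \<otimes>\<^bsub>P\<^esub> q)) n"
  proof (cases "k dvd n")
    case True
    then obtain m where m: "n = k * m" by blast
    have "(\<Oplus>i\<in>{..n}. ?f i) = (\<Oplus>i\<in>(*) k ` {..m}. ?f i)"
    proof (rule R.add.finprod_mono_neutral_cong_right)
      show "?f i = \<zero>" if "i \<in> {..n} - (*) k ` {..m}" for i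
      proof -
        have "\<not> k dvd i" using that k by (auto simp: m)
        then show ?thesis using assms by (simp add: coeff_poly_stretch poly_stretch_closed)
      qed
    qed (use cl in \<open>auto simp: m\<close>)
    also have "\<dots> = (\<Oplus>j\<in>{..m}. ?f (k * j))"
      using k cl by (intro R.add.finprod_reindex) (auto simp: inj_on_def)
    also have "\<dots> = (\<Oplus>j\<in>{..m}. up_ring.coeff P p j \<otimes> up_ring.coeff P q (m - j))"
      using assms by (intro R.finsum_cong') (auto simp: coeff_poly_stretch m simp flip: diff_mult_distrib2)
    finally show ?thesis using assms m by (simp add: coeff_poly_stretch)
  next
    case False
    have "?f i = \<zero>" if "i \<le> n" for i
    proof (cases "k dvd i")
      case True
      then have "\<not> k dvd n - i" using False that by (metis dvd_diffD)
      then show ?thesis using assms by (simp add: coeff_poly_stretch poly_stretch_closed)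
    qed (use assms in \<open>simp add: coeff_poly_stretch poly_stretch_closed\<close>)
    then have "(\<Oplus>i\<in>{..n}. ?f i) = (\<Oplus>i\<in>{..n}. \<zero>)" by (intro R.finsum_cong') auto
    then show ?thesis using False assms by (simp add: coeff_poly_stretch)
  qed
  then show "up_ring.coeff P (poly_stretch R k (p \<otimes>\<^bsub>P\<^esub> q)) n =
      up_ring.coeff P (poly_stretch R k p \<otimes>\<^bsub>P\<^esub> poly_stretch R k q) n"
    using assms by (simp add: poly_stretch_closed)
qed (use assms in \<open>simp_all add: poly_stretch_closed\<close>)

text \<open>The coefficients of \<open>p(x^k)\<close> are those of \<open>p\<close> padded with
  zeros. So an extended ideal is its own preimage under the substitution.\<close>

lemma poly_stretch_mem_poly_ideal:
  assumes "0 < k" "p \<in> carrier P" "ideal I R"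
  shows "poly_stretch R k p \<in> poly_ideal R I \<longleftrightarrow> p \<in> poly_ideal R I"
proof
  assume L: "poly_stretch R k p \<in> poly_ideal R I"
  have "up_ring.coeff P p n = up_ring.coeff P (poly_stretch R k p) (k * n)" for n
    using assms by (simp add: coeff_poly_stretch)
  then show "p \<in> poly_ideal R I" using L assms by (simp add: mem_poly_ideal)
qed (use assms additive_subgroup.zero_closed[OF ideal.axioms(1)[OF assms(3)]] in
  \<open>auto simp: mem_poly_ideal coeff_poly_stretch poly_stretch_closed\<close>)

text \<open>The shifted copies of \<open>g\<close> that make up \<open>g(x) p(x^k)\<close> do not overlap when \<open>k\<close> exceeds the
  degree of \<open>g\<close>.\<close>

lemma coeff_mult_poly_stretch:
  assumes "g \<in> carrier P" "p \<in> carrier P" "deg R g < k" "r < k"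
  shows "up_ring.coeff P (g \<otimes>\<^bsub>P\<^esub> poly_stretch R k p) (r + k * j) = up_ring.coeff P g r \<otimes> up_ring.coeff P p j"
proof -
  have k: "0 < k" using assms(4) by simp
  let ?f = "\<lambda>i. up_ring.coeff P g i \<otimes> up_ring.coeff P (poly_stretch R k p) (r + k * j - i)"
  have "(\<Oplus>i\<in>{..r + k * j}. ?f i) = (\<Oplus>i\<in>{r}. ?f i)"
  proof (rule R.add.finprod_mono_neutral_cong_right)
    show "?f i = \<zero>" if i: "i \<in> {..r + k * j} - {r}" for i
    proof (cases "i < k")
      case True
      \<comment> \<open>Otherwise \<open>i\<close> and \<open>r\<close>, both below
        \<open>k\<close>, would be congruent modulo \<open>k\<close> and hence equal.\<close>
      have "\<not> k dvd r + k * j - i"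
      proof
        assume "k dvd r + k * j - i"
        then obtain m where "r + k * j - i = k * m" by blast
        then have "r + k * j = i + k * m" using i le_add_diff_inverse[of i "r + k * j"] by simp
        then have "(r + k * j) mod k = (i + k * m) mod k" by simp
        then have "r mod k = i mod k" by simp
        then show False using True assms(4) i by simp
      qed
      then show ?thesis using assms k by (simp add: coeff_poly_stretch)
    next
      case False
      then have "up_ring.coeff P g i = \<zero>" using assms by (intro deg_aboveD) auto
      then show ?thesis using assms k by (simp add: poly_stretch_closed)
    qed
  qed (use assms k in \<open>auto simp: poly_stretch_closed\<close>)
  also have "\<dots> = up_ring.coeff P g r \<otimes> up_ring.coeff P p j"
    using assms k by (simp add: coeff_poly_stretch poly_stretch_closed)
  finally show ?thesis using assms k by (simp add: poly_stretch_closed)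
qed

section \<open>Hilbert's basis theorem\<close>

text \<open>The bound \<open>deg R p \<le> n\<close> lets the \<open>n\<close>-th coefficient
  vanish, which makes the set closed under addition.\<close>

lemma leading_coeffs_ideal:
  assumes "ideal I P"
  shows "ideal {up_ring.coeff P p n | p. p \<in> I \<and> deg R p \<le> n} R" (is "ideal ?L R")
proof -
  interpret I: ideal I P by fact
  have smult: "x \<otimes> a \<in> ?L" if ax: "a \<in> ?L" "x \<in> carrier R" for a x
  proof -
    obtain p where p: "a = up_ring.coeff P p n" "p \<in> I" "deg R p \<le> n" using ax(1) by blast
    have "x \<odot>\<^bsub>P\<^esub> p = up_ring.monom P x 0 \<otimes>\<^bsub>P\<^esub> p"
      using p ax(2) by (simp add: monom_mult_is_smult I.Icarr)
    then have "x \<odot>\<^bsub>P\<^esub> p \<in> I" using p ax(2) by (simp add: I.I_l_closed)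
    moreover have "deg R (x \<odot>\<^bsub>P\<^esub> p) \<le> n"
      using deg_smult_decr[of x p] p ax(2) I.Icarr by (meson le_trans)
    moreover have "up_ring.coeff P (x \<odot>\<^bsub>P\<^esub> p) n = x \<otimes> a"
      using p ax(2) I.Icarr by simp
    ultimately show ?thesis by (auto intro!: exI[of _ "x \<odot>\<^bsub>P\<^esub> p"])
  qed
  have sub: "?L \<subseteq> carrier R" using I.Icarr by auto
  show ?thesis
  proof (intro idealI subgroup.intro)
    show "x \<otimes>\<^bsub>add_monoid R\<^esub> y \<in> ?L" if xy: "x \<in> ?L" "y \<in> ?L" for x y
    proof -
      obtain p q where "x = up_ring.coeff P p n" "p \<in> I" "deg R p \<le> n"
        "y = up_ring.coeff P q n" "q \<in> I" "deg R q \<le> n" using xy by blast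
      moreover from this have "deg R (p \<oplus>\<^bsub>P\<^esub> q) \<le> n" "p \<oplus>\<^bsub>P\<^esub> q \<in> I"
        "up_ring.coeff P (p \<oplus>\<^bsub>P\<^esub> q) n = x \<oplus> y"
        using order_trans[OF deg_add[of p q]] I.Icarr by auto
      ultimately show ?thesis by (auto intro!: exI[of _ "p \<oplus>\<^bsub>P\<^esub> q"])
    qed
    show "\<one>\<^bsub>add_monoid R\<^esub> \<in> ?L"
      by (auto intro!: exI[of _ "\<zero>\<^bsub>P\<^esub>"])
    show "inv\<^bsub>add_monoid R\<^esub> x \<in> ?L" if x: "x \<in> ?L" for x
    proof -
      have "\<ominus> \<one> \<otimes> x \<in> ?L" using x by (intro smult) auto
      moreover have "\<ominus> \<one> \<otimes> x = \<ominus> x" using x sub by (simp add: R.l_minus subset_iff)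
      ultimately show ?thesis by (simp add: a_inv_def)
    qed
    show "a \<otimes> x \<in> ?L" if "a \<in> ?L" "x \<in> carrier R" for a x
    proof -
      have "a \<otimes> x = x \<otimes> a" using that sub by (intro R.m_comm) auto
      then show ?thesis using smult[OF that] by simp
    qed
  qed (use sub smult in \<open>auto simp: R.ring_axioms\<close>)
qed

text \<open>The ideals \<open>L I n\<close> of \<open>n\<close>-th coefficients increase with
  \<open>n\<close> and stabilise at some \<open>m\<close>. Finitely many elements of
  \<open>I\<close> whose coefficients generate \<open>L I n\<close> for \<open>n \<le> m\<close>
  generate a subideal \<open>H\<close> with \<open>L I n \<subseteq> L H n\<close> for all
  \<open>n\<close>; subtracting elements of \<open>H\<close> then lowers degrees until nothing
  remains.\<close>

theorem noetherian_UP: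
  assumes "noetherian_ring R"
  shows "noetherian_ring P"
proof (rule P.noetherian_ringI)
  interpret noetherian_ring R by fact
  fix I assume I: "ideal I P"
  interpret I: ideal I P by fact
  define L where "L I n = {up_ring.coeff P p n | p. p \<in> I \<and> deg R p \<le> n}" for I n
  have L: "ideal (L J n) R" if "ideal J P" for J n
    unfolding L_def using that by (rule leading_coeffs_ideal)
  have step: "L J n \<subseteq> L J (Suc n)" if J: "ideal J P" for J n
  proof
    interpret J: ideal J P by fact
    fix a assume "a \<in> L J n"
    then obtain p where p: "a = up_ring.coeff P p n" "p \<in> J" "deg R p \<le> n" by (auto simp: L_def)
    let ?q = "up_ring.monom P \<one> 1 \<otimes>\<^bsub>P\<^esub> p"
    have pc: "p \<in> carrier P" using p J.Icarr by simp
    have "?q \<in> J" using p by (simp add: J.I_l_closed)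
    moreover have "up_ring.coeff P ?q (Suc n) = a"
      using coeff_monom_mult[of \<one> p 1 n] pc p by simp
    moreover have "deg R ?q \<le> Suc n"
      using deg_mult_ring[of "up_ring.monom P \<one> 1" p] deg_monom_le[of \<one> 1] pc p(3)
      by simp
    ultimately show "a \<in> L J (Suc n)" unfolding L_def by blast
  qed
  have mono: "L J m \<subseteq> L J n" if "ideal J P" "m \<le> n" for J m n
    using step[OF that(1)] that(2) by (rule lift_Suc_mono_le)
  have "subset.chain {I. ideal I R} (range (L I))"
  proof -
    have "L I i \<subseteq> L I j \<or> L I j \<subseteq> L I i" for i j
      using mono[OF I, of i j] mono[OF I, of j i] by (cases "i \<le> j") auto
    then show ?thesis unfolding subset.chain_def using L[OF I] by blast
  qed
  then have "\<Union> (range (L I)) \<in> range (L I)"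
    by (intro ideal_chain_is_trivial) auto
  then obtain m where m: "\<And>n. L I n \<subseteq> L I m" by blast
  have "\<exists>S. finite S \<and> S \<subseteq> I \<and> (\<forall>p\<in>S. deg R p \<le> n) \<and>
      L I n = genideal R ((\<lambda>p. up_ring.coeff P p n) ` S)" for n
  proof -
    obtain B where B: "B \<subseteq> carrier R" "finite B" "L I n = genideal R B"
      using finetely_gen[OF L[OF I, of n]] by blast
    then have "B \<subseteq> L I n" using R.genideal_self by blast
    then have "B \<subseteq> (\<lambda>p. up_ring.coeff P p n) ` {p \<in> I. deg R p \<le> n}" by (auto simp: L_def)
    then obtain S where "S \<subseteq> {p \<in> I. deg R p \<le> n}" "finite S" "B = (\<lambda>p. up_ring.coeff P p n) ` S"
      using B(2) by (meson finite_subset_image)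
    then show ?thesis using B(3) by (intro exI[of _ S]) auto
  qed
  then obtain S where S: "\<And>n. finite (S n)" "\<And>n. S n \<subseteq> I" "\<And>n p. p \<in> S n \<Longrightarrow> deg R p \<le> n"
    "\<And>n. L I n = genideal R ((\<lambda>p. up_ring.coeff P p n) ` S n)" by metis
  define G where "G = (\<Union>n\<le>m. S n)"
  have G: "finite G" "G \<subseteq> I" using S by (auto simp: G_def)
  then have Gc: "G \<subseteq> carrier P" using I.Icarr by blast
  define H where "H = genideal P G"
  have H: "ideal H P" unfolding H_def using Gc by (rule P.genideal_ideal)
  have "H \<subseteq> I" unfolding H_def using I G(2) by (rule P.genideal_minimal)
  have GH: "G \<subseteq> H" unfolding H_def using Gc by (rule P.genideal_self)
  have low: "L I n \<subseteq> L H n" if "n \<le> m" for n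
    unfolding S(4)[of n]
  proof (rule R.genideal_minimal[OF L[OF H]])
    show "(\<lambda>p. up_ring.coeff P p n) ` S n \<subseteq> L H n"
      using that GH S(3)[of _ n] by (auto simp: L_def G_def)
  qed
  have "L I n \<subseteq> L H n" for n
  proof (cases "n \<le> m")
    case False
    then show ?thesis using m[of n] low[of m] mono[OF H, of m n] by auto
  qed (rule low)
  note LH = this
  interpret H: ideal H P by (rule H)
  have "p \<in> H" if "p \<in> I" "deg R p < n" for p n
    using that
  proof (induct n arbitrary: p)
    case (Suc n)
    then have "up_ring.coeff P p n \<in> L I n" by (auto simp: L_def)
    then have "up_ring.coeff P p n \<in> L H n" using LH by blast
    then obtain h where h: "up_ring.coeff P p n = up_ring.coeff P h n" "h \<in> H" "deg R h \<le> n"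
      by (auto simp: L_def)
    have pc: "p \<in> carrier P" "h \<in> carrier P" using Suc(2) h I.Icarr H.Icarr by auto
    have "p \<ominus>\<^bsub>P\<^esub> h \<in> I" using Suc(2) h(2) \<open>H \<subseteq> I\<close> by (auto simp: a_minus_def)
    have coeff0: "up_ring.coeff P (p \<ominus>\<^bsub>P\<^esub> h) i = \<zero>" if "n \<le> i" for i
    proof (cases "i = n")
      case True
      then show ?thesis using pc h by (simp add: R.r_neg a_minus_def)
    next
      case False
      then have "deg R p < i" "deg R h < i" using that Suc(3) h by auto
      then show ?thesis using pc by (simp add: deg_aboveD a_minus_def)
    qed
    have "p \<ominus>\<^bsub>P\<^esub> h \<in> H"
    \<comment> \<open>The zero polynomial also has degree 0. For \<open>n = 0\<close> the difference
      is therefore shown to be zero itself; for \<open>n = Suc k\<close> its degree is at most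
      \<open>k\<close> and the induction hypothesis applies.\<close>
    proof (cases n)
      case 0
      then have "p \<ominus>\<^bsub>P\<^esub> h = \<zero>\<^bsub>P\<^esub>" using coeff0 pc by (intro up_eqI) auto
      then show ?thesis by simp
    next
      case (Suc k)
      have "deg R (p \<ominus>\<^bsub>P\<^esub> h) \<le> k"
        using coeff0 pc Suc by (intro deg_aboveI) auto
      then show ?thesis using Suc.hyps \<open>p \<ominus>\<^bsub>P\<^esub> h \<in> I\<close> Suc by simp
    qed
    then have "(p \<ominus>\<^bsub>P\<^esub> h) \<oplus>\<^bsub>P\<^esub> h \<in> H" using h by simp
    moreover have "(p \<ominus>\<^bsub>P\<^esub> h) \<oplus>\<^bsub>P\<^esub> h = p" using pc by (simp add: a_minus_def P.a_assoc P.l_neg)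
    ultimately show ?case by simp
  qed simp
  then have "I = H" using \<open>H \<subseteq> I\<close> by blast
  then show "\<exists>A\<subseteq>carrier P. finite A \<and> I = genideal P A" using G Gc H_def by blast
qed

section \<open>Maximal collections of extended ideals\<close>

text \<open>For \<open>g \<in> G\<close> let \<open>?J\<close> be the colon ideal of \<alpha> by the
  coefficients of \<open>g\<close>. The infinite set \<open>K\<close> has a \<open>k\<close> beyond
  any given degree and index, and then each product of a coefficient of \<open>g\<close> and one of
  \<open>p \<in> N\<close> is a coefficient of \<open>g(x) p(x^k)\<close>. Hence \<open>c(N)\<close>
  lies in \<open>?J\<close>.\<close>

lemma prod_poly_content_subset:
  assumes "ideal \<alpha> R" "G \<subseteq> carrier P" "N \<subseteq> carrier P" "infinite K"
    and "\<And>k g p. k \<in> K \<Longrightarrow> g \<in> G \<Longrightarrow> p \<in> N \<Longrightarrow> g \<otimes>\<^bsub>P\<^esub> poly_stretch R k p \<in> poly_ideal R \<alpha>"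
  shows "ideal_prod P G (poly_ideal R (poly_content R N)) \<subseteq> poly_ideal R \<alpha>"
proof (subst ideal_prod_subset_iff[OF poly_ideal_ideal[OF assms(1)]], intro ballI)
  fix g q assume g: "g \<in> G" and q: "q \<in> poly_ideal R (poly_content R N)"
  then have gc: "g \<in> carrier P" using assms(2) by blast
  let ?J = "{a \<in> carrier R. \<forall>s\<in>range (up_ring.coeff P g). s \<otimes> a \<in> \<alpha>}"
  have J: "ideal ?J R"
    using gc by (intro R.colon_ideal assms) auto
  have "N \<subseteq> poly_ideal R ?J"
  proof
    fix p assume p: "p \<in> N"
    then have pc: "p \<in> carrier P" using assms(3) by blast
    have "up_ring.coeff P g r \<otimes> up_ring.coeff P p j \<in> \<alpha>" for r j
    proof -
      obtain k where k: "k \<in> K" "max (deg R g) r < k"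
        using assms(4) unfolding infinite_nat_iff_unbounded by blast
      then have "up_ring.coeff P (g \<otimes>\<^bsub>P\<^esub> poly_stretch R k p) (r + k * j) \<in> \<alpha>"
        using assms(5)[OF k(1) g p] by (simp only: mem_poly_ideal)
      then show ?thesis using coeff_mult_poly_stretch[OF gc pc] k(2) by simp
    qed
    then show "p \<in> poly_ideal R ?J" using pc by (auto simp: mem_poly_ideal)
  qed
  then have "poly_content R N \<subseteq> ?J"
    using poly_content_subset_iff[OF assms(3) J] by blast
  then have q': "up_ring.coeff P q n \<in> ?J" and qc: "q \<in> carrier P" for n
    using q by (auto simp: mem_poly_ideal)
  interpret \<alpha>: ideal \<alpha> R by fact
  have "(\<Oplus>i\<in>{..n}. up_ring.coeff P g i \<otimes> up_ring.coeff P q (n - i)) \<in> \<alpha>" for n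
    using q' by (intro \<alpha>.finsum_mem R.abelian_monoid_axioms) auto
  then show "g \<otimes>\<^bsub>P\<^esub> q \<in> poly_ideal R \<alpha>"
    using gc qc by (simp add: mem_poly_ideal)
qed

text \<open>Induction with \<open>G\<close> as an accumulator of the factors already replaced. Its
  product with the tail \<open>Ls\<close> takes the place of \<open>G\<close> in
  \<open>prod_poly_content_subset\<close> when the head \<open>L\<close> is exchanged for
  \<open>c(N)[x]\<close>.\<close>

lemma prod_map_poly_content_subset:
  assumes "ideal \<alpha> R" "ideal G P" "infinite K"
    and "list_all2 (\<lambda>N L. ideal N P \<and> ideal L P \<and> (\<forall>k\<in>K. poly_stretch R k ` N \<subseteq> L)) Ns Ls"
    and "ideal_prod P G (ideals_prod P Ls) \<subseteq> poly_ideal R \<alpha>"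
  shows "ideal_prod P G (ideals_prod P (map (\<lambda>N. poly_ideal R (poly_content R N)) Ns)) \<subseteq> poly_ideal R \<alpha>"
  using assms(4,2,5)
proof (induct Ns Ls arbitrary: G rule: list_all2_induct)
  case (Cons N Ns L Ls)
  let ?c = "\<lambda>N. poly_ideal R (poly_content R N)"
  have c: "ideal (?c M) P" if "ideal M P" for M
    using that ideal.Icarr[OF that] by (intro poly_ideal_ideal poly_content_ideal) auto
  have id: "ideal M P" if "M \<in> set Ns \<union> set Ls" for M
    using Cons(2) that by (auto simp: list_all2_conv_all_nth in_set_conv_nth)
  have N: "ideal N P" "ideal L P" "\<And>k. k \<in> K \<Longrightarrow> poly_stretch R k ` N \<subseteq> L" using Cons(1) by auto
  have prods: "ideal (ideals_prod P Ls) P" "ideal (ideals_prod P (map ?c Ns)) P"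
    using id c by (auto intro!: P.ideals_prod_ideal)
  let ?G = "ideal_prod P G (ideals_prod P Ls)"
  have G: "ideal ?G P" using Cons(4) prods by (intro P.ideal_prod_is_ideal)
  have "ideal_prod P ?G L = ideal_prod P G (ideals_prod P (L # Ls))"
    using Cons(4) prods N by (simp add: P.ideal_prod_assoc P.ideal_prod_commute[of L])
  then have sub: "ideal_prod P ?G L \<subseteq> poly_ideal R \<alpha>" using Cons(5) by simp
  have "ideal_prod P ?G (?c N) \<subseteq> poly_ideal R \<alpha>"
  proof (rule prod_poly_content_subset[OF assms(1) _ _ assms(3)])
    show "g \<otimes>\<^bsub>P\<^esub> poly_stretch R k p \<in> poly_ideal R \<alpha>" if "k \<in> K" "g \<in> ?G" "p \<in> N" for k g p
      using sub ideal_prod.prod[of g ?G "poly_stretch R k p" L P] N(3)[OF that(1)] that by blast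
  qed (use G N(1) in \<open>auto dest: ideal.Icarr\<close>)
  moreover have "ideal_prod P ?G (?c N) = ideal_prod P (ideal_prod P G (?c N)) (ideals_prod P Ls)"
    using Cons(4) prods c[OF N(1)] P.ideal_prod_commute[of "ideals_prod P Ls" "?c N"]
    by (simp add: P.ideal_prod_assoc)
  ultimately have "ideal_prod P (ideal_prod P G (?c N)) (ideals_prod P (map ?c Ns)) \<subseteq> poly_ideal R \<alpha>"
    using Cons(3)[of "ideal_prod P G (?c N)"] Cons(4) c[OF N(1)] by (simp add: P.ideal_prod_is_ideal)
  then show ?case
    using Cons(4) prods c[OF N(1)] by (simp add: P.ideal_prod_assoc)
qed simp

section \<open>Collections under the substitution \<open>x \<mapsto> x^k\<close>\<close>

lemma stretch_ideal:
  assumes "ideal I P" "0 < k"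
  shows "ideal (genideal P (poly_stretch R k ` I)) P" "poly_stretch R k ` I \<subseteq> genideal P (poly_stretch R k ` I)"
proof -
  have "poly_stretch R k ` I \<subseteq> carrier P"
    using assms by (auto simp: poly_stretch_closed dest: ideal.Icarr)
  then show "ideal (genideal P (poly_stretch R k ` I)) P" "poly_stretch R k ` I \<subseteq> genideal P (poly_stretch R k ` I)"
    by (rule P.genideal_ideal, rule P.genideal_self)
qed

text \<open>Extension of ideals along a ring endomorphism is multiplicative. For this half, products
  of the generating images are images of products.\<close>

lemma prod_stretch_ideals_subset:
  assumes "0 < k" "\<And>I. I \<in> set Is \<Longrightarrow> ideal I P"
  shows "ideals_prod P (map (\<lambda>I. genideal P (poly_stretch R k ` I)) Is)
    \<subseteq> genideal P (poly_stretch R k ` ideals_prod P Is)"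
  using assms(2)
proof (induct Is)
  case Nil
  note C = stretch_ideal[OF P.oneideal assms(1)]
  have "\<one>\<^bsub>P\<^esub> \<in> genideal P (poly_stretch R k ` carrier P)"
    using C(2) poly_stretch_one[OF assms(1)] P.one_closed by (metis image_eqI subsetD)
  then show ?case using ideal.one_imp_carrier[OF C(1)] by simp
next
  case (Cons I Is)
  let ?e = "\<lambda>I. genideal P (poly_stretch R k ` I)"
  have I: "ideal I P" and Is: "ideal (ideals_prod P Is) P"
    using Cons(2) by (auto intro: P.ideals_prod_ideal)
  note IIs = P.ideal_prod_is_ideal[OF I Is]
  have carr: "poly_stretch R k ` J \<subseteq> carrier P" if "ideal J P" for J
    using that assms(1) by (auto simp: poly_stretch_closed dest: ideal.Icarr)
  have "ideals_prod P (map ?e (I # Is)) \<subseteq> ideal_prod P (?e I) (?e (ideals_prod P Is))"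
    using Cons by (simp add: ideal_prod_mono)
  also have "\<dots> \<subseteq> ?e (ideal_prod P I (ideals_prod P Is))"
  proof (rule P.prod_genideal_subset[OF stretch_ideal(1)[OF IIs assms(1)] carr[OF I] carr[OF Is]])
    fix s t assume "s \<in> poly_stretch R k ` I" "t \<in> poly_stretch R k ` ideals_prod P Is"
    then obtain p q where pq: "s = poly_stretch R k p" "p \<in> I" "t = poly_stretch R k q" "q \<in> ideals_prod P Is"
      by blast
    then have "s \<otimes>\<^bsub>P\<^esub> t = poly_stretch R k (p \<otimes>\<^bsub>P\<^esub> q)"
      using assms(1) ideal.Icarr[OF I] ideal.Icarr[OF Is] by (simp add: poly_stretch_mult)
    then show "s \<otimes>\<^bsub>P\<^esub> t \<in> ?e (ideal_prod P I (ideals_prod P Is))"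
      using stretch_ideal(2)[OF IIs assms(1)] pq by (auto intro!: ideal_prod.prod)
  qed
  finally show ?case by simp
qed

text \<open>The other half of multiplicativity, stated for the image instead of the ideal that it
  generates.\<close>

lemma stretch_prod_subset:
  assumes "0 < k" "\<And>I. I \<in> set Is \<Longrightarrow> ideal I P"
  shows "poly_stretch R k ` ideals_prod P Is
    \<subseteq> ideals_prod P (map (\<lambda>I. genideal P (poly_stretch R k ` I)) Is)"
  using assms(2)
proof (induct Is)
  case Nil
  then show ?case using assms(1) by (auto simp: poly_stretch_closed)
next
  case (Cons I Is)
  have I: "ideal I P" and Is: "ideal (ideals_prod P Is) P"
    using Cons(2) by (auto intro: P.ideals_prod_ideal)
  have "p \<in> carrier P \<and> poly_stretch R k p \<in> ideals_prod P (map (\<lambda>I. genideal P (poly_stretch R k ` I)) (I # Is))"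
    if "p \<in> ideal_prod P I (ideals_prod P Is)" for p
    using that
  proof induct
    case (prod i j)
    then have "i \<in> carrier P" "j \<in> carrier P" using ideal.Icarr[OF I] ideal.Icarr[OF Is] by auto
    moreover have "poly_stretch R k i \<in> genideal P (poly_stretch R k ` I)"
      using stretch_ideal(2)[OF I assms(1)] prod(1) by auto
    moreover have "poly_stretch R k j \<in> ideals_prod P (map (\<lambda>I. genideal P (poly_stretch R k ` I)) Is)"
      using Cons prod(2) by auto
    ultimately show ?case using assms(1) by (simp add: poly_stretch_mult ideal_prod.prod)
  next
    case (sum p q)
    then show ?case using assms(1) by (simp add: poly_stretch_add ideal_prod.sum)
  qed
  then show ?case by auto
qed

text \<open>As \<alpha>[x] is its own preimage under the substitution, a subproduct of the stretched
  ideals lies in \<alpha>[x] exactly when the original subproduct does. Both conditions on a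
  collection are thus transferred.\<close>

lemma collection_stretch:
  assumes "ideal \<alpha> R" "0 < k" "collection P (poly_ideal R \<alpha>) N"
  shows "collection P (poly_ideal R \<alpha>) (map (\<lambda>I. genideal P (poly_stretch R k ` I)) N)" (is "collection P ?T (map ?e N)")
proof -
  have N: "\<And>I. I \<in> set N \<Longrightarrow> ideal I P" "ideals_prod P N \<subseteq> ?T"
    "\<And>j. j < length N \<Longrightarrow> \<not> ideals_prod P (take j N @ drop (Suc j) N) \<subseteq> ?T"
    using assms(3) by (auto simp: collection_def)
  have T: "ideal ?T P" using assms(1) by (rule poly_ideal_ideal)
  have iff: "ideals_prod P (map ?e D) \<subseteq> ?T \<longleftrightarrow> ideals_prod P D \<subseteq> ?T" if "set D \<subseteq> set N" for D
  proof -
    have D: "\<And>I. I \<in> set D \<Longrightarrow> ideal I P" using that N(1) by auto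
    then have Dc: "ideals_prod P D \<subseteq> carrier P" by (intro ideal_subset_carrier P.ideals_prod_ideal)
    have st: "poly_stretch R k ` ideals_prod P D \<subseteq> ?T \<longleftrightarrow> ideals_prod P D \<subseteq> ?T"
      using poly_stretch_mem_poly_ideal[OF assms(2) subsetD[OF Dc] assms(1)]
      unfolding image_subset_iff subset_eq by simp
    show ?thesis
    proof
      assume "ideals_prod P (map ?e D) \<subseteq> ?T"
      then show "ideals_prod P D \<subseteq> ?T"
        using stretch_prod_subset[OF assms(2) D] st by (meson order_trans)
    next
      assume "ideals_prod P D \<subseteq> ?T"
      then have "genideal P (poly_stretch R k ` ideals_prod P D) \<subseteq> ?T"
        using st by (intro P.genideal_minimal[OF T]) simp
      then show "ideals_prod P (map ?e D) \<subseteq> ?T"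
        using prod_stretch_ideals_subset[OF assms(2) D] by (meson order_trans)
    qed
  qed
  have "\<not> ideals_prod P (take j (map ?e N) @ drop (Suc j) (map ?e N)) \<subseteq> ?T" if "j < length N" for j
    using iff[of "take j N @ drop (Suc j) N"] N(3)[OF that] set_take_subset[of j N] set_drop_subset[of "Suc j" N]
    by (simp add: take_map drop_map)
  then show ?thesis
    using N iff[of N] stretch_ideal(1)[OF _ assms(2)] by (auto simp: collection_def)
qed

section \<open>Extendedness of the maximal collections of \<alpha>[x]\<close>

theorem maximal_collection_poly_ideal_extended:
  assumes "noetherian_ring R" "ideal \<alpha> R"
    and fin: "finite {M. maximal_collection P (poly_ideal R \<alpha>) M}"
    and N0: "maximal_collection P (poly_ideal R \<alpha>) N0"
  shows "\<forall>I\<in>set N0. \<exists>J. ideal J R \<and> I = poly_ideal R J"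
proof (rule ccontr)
  assume not: "\<not> ?thesis"
  interpret P: noetherian_comm_ring P
    using noetherian_UP[OF assms(1)] P.cring_axioms by (simp add: noetherian_comm_ring_def)
  let ?T = "poly_ideal R \<alpha>"
  have T: "ideal ?T P" using assms(2) by (rule poly_ideal_ideal)
  define E where "E N \<longleftrightarrow> (\<forall>I\<in>set N. \<exists>J. ideal J R \<and> I = poly_ideal R J)" for N
  obtain b where b: "\<And>C. collection P ?T C \<Longrightarrow> length C \<le> b"
    using P.collection_length_bounded[OF T] by blast
  \<comment> \<open>Lengths are bounded and \<open>N0\<close> is a candidate, so a longest maximal
    collection with a non-extended entry exists.\<close>
  have "\<exists>N. (maximal_collection P ?T N \<and> \<not> E N) \<and>
      (\<forall>M. maximal_collection P ?T M \<and> \<not> E M \<longrightarrow> length M \<le> length N)"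
    using N0 not b by (intro ex_has_greatest_nat[of _ N0 _ "Suc b"])
      (auto simp: E_def maximal_collection_def le_imp_less_Suc)
  then obtain N where N: "maximal_collection P ?T N" "\<not> E N"
    and max: "\<And>M. maximal_collection P ?T M \<Longrightarrow> length N < length M \<Longrightarrow> E M"
    by (meson not_le)
  have colN: "collection P ?T N" using N(1) by (simp add: maximal_collection_def)
  then have Nid: "\<And>i. i < length N \<Longrightarrow> ideal (N ! i) P" by (auto simp: collection_def)
  \<comment> \<open>\<open>Suc k\<close> keeps the exponent of the substitution positive.\<close>
  let ?e = "\<lambda>k I. genideal P (poly_stretch R (Suc k) ` I)"
  have "\<exists>M. maximal_collection P ?T M \<and> length N \<le> length M \<and> (\<forall>i<length N. ?e k (N ! i) \<subseteq> M ! i)" for k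
    using P.maximal_collection_above[OF T collection_stretch[OF assms(2) _ colN, of "Suc k"]]
    by (metis length_map nth_map zero_less_Suc)
  then obtain D where D: "\<And>k. maximal_collection P ?T (D k)" "\<And>k. length N \<le> length (D k)"
    "\<And>k i. i < length N \<Longrightarrow> ?e k (N ! i) \<subseteq> D k ! i" by metis
  \<comment> \<open>Finiteness of the set of maximal collections enters here: by pigeonhole, one
    value \<open>L\<close> of \<open>D\<close> is taken infinitely often.\<close>
  have "finite (range D)" using D(1) by (intro finite_subset[OF _ fin]) auto
  then obtain k0 where k0: "infinite {k \<in> UNIV. D k = D k0}"
    using pigeonhole_infinite[of UNIV D] by auto
  define L where "L = D k0"
  define K where "K = Suc ` {k. D k = L}"
  have K: "infinite K" using k0 by (simp add: K_def L_def finite_image_iff)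
  have L: "maximal_collection P ?T L" "length N \<le> length L" using D by (simp_all add: L_def)
  have colL: "collection P ?T L" using L(1) by (simp add: maximal_collection_def)
  have st: "poly_stretch R k ` (N ! i) \<subseteq> L ! i" if "k \<in> K" "i < length N" for k i
    using that D(3)[of i] stretch_ideal(2)[OF Nid[OF that(2)]] by (fastforce simp: K_def)
  have Npos: "0 < k" if "k \<in> K" for k using that by (auto simp: K_def)
  show False
  proof (cases "length N < length L")
    case True
    have "N ! i \<subseteq> L ! i" if i: "i < length N" for i
    proof
      fix p assume p: "p \<in> N ! i"
      \<comment> \<open>A single exponent suffices in this case: \<open>L ! i\<close> is extended,
        so it contains \<open>p\<close> as soon as it contains \<open>p(x^k)\<close>.\<close>
      obtain k where k: "k \<in> K" using K by fastforce
      obtain J where J: "ideal J R" "L ! i = poly_ideal R J"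
        using max[OF L(1) True] i True unfolding E_def by (meson less_trans nth_mem)
      have "poly_stretch R k p \<in> poly_ideal R J" using st[OF k i] p J by auto
      then show "p \<in> L ! i"
        using poly_stretch_mem_poly_ideal[OF Npos[OF k] ideal.Icarr[OF Nid[OF i] p] J(1)] J(2) by simp
    qed
    then have "lies_below N L" using True by (auto simp: lies_below_def reordering_def)
    with N(1) colL have "mset L = mset N"
      by (rule maximal_collectionD)
    then have "length L = length N" by (rule mset_eq_length)
    then show False using True by simp
  next
    case False
    then have len: "length L = length N" using L(2) by simp
    let ?c = "\<lambda>I. poly_ideal R (poly_content R I)"
    have sub: "ideal_prod P (carrier P) (ideals_prod P (map ?c N)) \<subseteq> ?T"
    proof (rule prod_map_poly_content_subset[OF assms(2) P.oneideal K])
      show "list_all2 (\<lambda>N L. ideal N P \<and> ideal L P \<and> (\<forall>k\<in>K. poly_stretch R k ` N \<subseteq> L)) N L"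
        using len Nid st colL by (auto simp: list_all2_conv_all_nth collection_def)
      have "ideal_prod P (carrier P) (ideals_prod P L) \<subseteq> ideals_prod P L"
        using P.ideal_prod_inter[OF P.oneideal P.ideals_prod_ideal[of L]] colL by (auto simp: collection_def)
      then show "ideal_prod P (carrier P) (ideals_prod P L) \<subseteq> ?T"
        using colL by (auto simp: collection_def)
    qed
    have Nc: "I \<subseteq> carrier P" if "I \<in> set N" for I
      using colN that by (intro ideal_subset_carrier) (simp add: collection_def)
    have cid: "ideal (?c I) P" "ideal (poly_content R I) R" if "I \<in> set N" for I
      using Nc[OF that] by (auto intro: poly_ideal_ideal poly_content_ideal)
    have "ideal (ideals_prod P (map ?c N)) P" using cid by (intro P.ideals_prod_ideal) auto
    then have prod: "ideals_prod P (map ?c N) \<subseteq> ?T"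
      using sub P.ideal_prod_commute[OF P.oneideal] P.ideal_prod_one by simp
    have "collection P ?T (map ?c N)"
      unfolding collection_def
    proof (intro conjI allI impI)
      fix j assume j: "j < length (map ?c N)"
      \<comment> \<open>Each \<open>N ! i\<close> lies in its \<open>?c\<close>, so the products
        with one entry removed only grow and are still not contained in \<alpha>[x].\<close>
      have "list_all2 (\<subseteq>) (take j N @ drop (Suc j) N) (take j (map ?c N) @ drop (Suc j) (map ?c N))"
        using Nc subset_poly_ideal_content
        by (intro list_all2_appendI list_all2_takeI list_all2_dropI)
          (auto simp: list_all2_conv_all_nth)
      then have "ideals_prod P (take j N @ drop (Suc j) N)
          \<subseteq> ideals_prod P (take j (map ?c N) @ drop (Suc j) (map ?c N))"
        by (rule ideals_prod_mono)
      moreover have "\<not> ideals_prod P (take j N @ drop (Suc j) N) \<subseteq> ?T"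
        using colN j by (simp add: collection_def)
      ultimately show "\<not> ideals_prod P (take j (map ?c N) @ drop (Suc j) (map ?c N)) \<subseteq> ?T"
        by (meson order_trans)
    qed (use cid prod in auto)
    moreover have "lies_below N (map ?c N)"
      using Nc subset_poly_ideal_content unfolding lies_below_def reordering_def
      by (intro conjI exI[of _ "map ?c N"]) auto
    ultimately have "mset (map ?c N) = mset N"
      by (rule maximal_collectionD[OF N(1)])
    \<comment> \<open>The reordering may move entries, but being extended concerns only the set of
      entries.\<close>
    then have "set (map ?c N) = set N" by (rule mset_eq_setD)
    then have "\<exists>J. ideal J R \<and> I = poly_ideal R J" if "I \<in> set N" for I
      using that cid(2) by (metis (no_types, lifting) imageE list.set_map)
    then have "E N" unfolding E_def by blast
    then show False using N(2) by simp
  qed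
qed

text \<open>An ideal of \<open>R\<close> underlying each entry of \<open>N\<close> gives
  \<open>M\<close>. If a collection \<open>C\<close> lies above \<open>M\<close>, then
  \<open>C[x]\<close> lies above \<open>M[x] = N\<close> and so is a reordering of it; applying
  \<open>poly_content\<close> carries this back to \<open>C\<close> and \<open>M\<close>.\<close>

theorem maximal_collections_extended_UP:
  assumes "noetherian_ring R" "ideal \<alpha> R" "finite {M. maximal_collection P (poly_ideal R \<alpha>) M}"
  shows "maximal_collections_extended R \<alpha>"
  unfolding maximal_collections_extended_def P_def[symmetric]
proof (intro allI impI)
  fix N assume N: "maximal_collection P (poly_ideal R \<alpha>) N"
  have "\<forall>I\<in>set N. \<exists>J. ideal J R \<and> I = poly_ideal R J"
    using assms N by (rule maximal_collection_poly_ideal_extended)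
  then obtain f where f: "\<And>I. I \<in> set N \<Longrightarrow> ideal (f I) R \<and> I = poly_ideal R (f I)" by metis
  define M where "M = map f N"
  have NM: "N = map (poly_ideal R) M" unfolding M_def map_map by (rule map_idI[symmetric]) (use f in simp)
  have Mid: "\<And>J. J \<in> set M \<Longrightarrow> ideal J R" using f by (auto simp: M_def)
  have colM: "collection R \<alpha> M"
    using N collection_poly_ideal_iff[OF assms(2) Mid] by (simp add: NM maximal_collection_def)
  have "reordering C M" if C: "collection R \<alpha> C" "lies_below M C" for C
  proof -
    have Cid: "\<And>J. J \<in> set C \<Longrightarrow> ideal J R" using C(1) by (auto simp: collection_def)
    obtain D where D: "mset D = mset C" "length M \<le> length C" "\<And>i. i < length M \<Longrightarrow> M ! i \<subseteq> D ! i"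
      using C(2) by (auto simp: lies_below_def reordering_def)
    have lenD: "length D = length C" using D(1) by (rule mset_eq_length)
    have "lies_below N (map (poly_ideal R) C)"
      unfolding lies_below_def reordering_def
    proof (intro conjI exI[of _ "map (poly_ideal R) D"])
      show "\<forall>i<length N. N ! i \<subseteq> map (poly_ideal R) D ! i"
        using D(2,3) lenD by (simp add: NM poly_ideal_mono)
    qed (use D in \<open>simp_all add: NM\<close>)
    moreover have "collection P (poly_ideal R \<alpha>) (map (poly_ideal R) C)"
      using collection_poly_ideal_iff[OF assms(2) Cid] C(1) by simp
    ultimately have eq: "mset (map (poly_ideal R) C) = mset (map (poly_ideal R) M)"
      using maximal_collectionD[OF N] NM by blast
    have inv: "map (poly_content R) (map (poly_ideal R) Js) = Js"
      if "\<And>J. J \<in> set Js \<Longrightarrow> ideal J R" for Js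
      unfolding map_map by (rule map_idI) (use that in \<open>simp add: poly_content_poly_ideal\<close>)
    have "mset C = image_mset (poly_content R) (mset (map (poly_ideal R) C))"
      using inv[OF Cid] by (metis mset_map)
    also have "\<dots> = mset M"
      unfolding eq using inv[OF Mid] by (metis mset_map)
    finally show ?thesis by (simp add: reordering_def)
  qed
  then have "maximal_collection R \<alpha> M" using colM by (simp add: maximal_collection_def)
  then show "\<exists>M. maximal_collection R \<alpha> M \<and> N = map (poly_ideal R) M" using NM by blast
qed

end

text \<open>\<^const>\<open>all_noetherian_finitely_many\<close> is about plain ring records, whereas \<^term>\<open>UP A\<close> carries
  additional fields.\<close>

lemma truncate_simps [simp]:
  "carrier (ring.truncate R) = carrier R" "(\<otimes>\<^bsub>ring.truncate R\<^esub>) = (\<otimes>\<^bsub>R\<^esub>)"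
  "\<one>\<^bsub>ring.truncate R\<^esub> = \<one>\<^bsub>R\<^esub>" "\<zero>\<^bsub>ring.truncate R\<^esub> = \<zero>\<^bsub>R\<^esub>"
  "(\<oplus>\<^bsub>ring.truncate R\<^esub>) = (\<oplus>\<^bsub>R\<^esub>)"
  by (simp_all add: ring.defs)

lemma ring_truncate:
  assumes "ring R"
  shows "ring (ring.truncate R)"
proof -
  interpret ring R by fact
  have "\<exists>y\<in>carrier R. y \<oplus>\<^bsub>R\<^esub> x = \<zero>\<^bsub>R\<^esub>" if "x \<in> carrier R" for x
    using that l_neg a_inv_closed by blast
  then show ?thesis
    by (intro ringI abelian_groupI monoidI) (auto simp: a_ac m_assoc l_distr r_distr)
qed

lemma cring_truncate:
  assumes "cring R"
  shows "cring (ring.truncate R)"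
proof -
  interpret cring R by fact
  show ?thesis
    by (intro cring.intro ring_truncate ring_axioms comm_monoid.intro ring.is_monoid comm_monoid_axioms.intro)
      (simp add: m_comm)
qed

text \<open>Additive inverses are given by a description in terms of carrier, operation and unit, so
  they survive the truncation, and with them the notion of a subgroup.\<close>

lemma ideal_truncate:
  assumes "ring R"
  shows "ideal I (ring.truncate R) \<longleftrightarrow> ideal I R"
proof -
  have "m_inv (add_monoid (ring.truncate R)) x = m_inv (add_monoid R) x" for x
    by (simp add: m_inv_def)
  then have "subgroup I (add_monoid (ring.truncate R)) \<longleftrightarrow> subgroup I (add_monoid R)"
    by (simp add: subgroup_def)
  then show ?thesis
    using assms ring_truncate[OF assms]
    by (simp add: ideal_def ideal_axioms_def additive_subgroup_def)
qed

lemma ideal_prod_truncate: "ideal_prod (ring.truncate R) I J = ideal_prod R I J"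
proof
  show "ideal_prod (ring.truncate R) I J \<subseteq> ideal_prod R I J"
  proof
    fix x assume "x \<in> ideal_prod (ring.truncate R) I J"
    then show "x \<in> ideal_prod R I J"
      by induct (auto intro: ideal_prod.intros)
  qed
  have "i \<otimes>\<^bsub>R\<^esub> j \<in> ideal_prod (ring.truncate R) I J" if "i \<in> I" "j \<in> J" for i j
    using ideal_prod.prod[OF that, of "ring.truncate R"] by simp
  moreover have "a \<oplus>\<^bsub>R\<^esub> b \<in> ideal_prod (ring.truncate R) I J"
    if "a \<in> ideal_prod (ring.truncate R) I J" "b \<in> ideal_prod (ring.truncate R) I J" for a b
    using ideal_prod.sum[OF that] by simp
  ultimately show "ideal_prod R I J \<subseteq> ideal_prod (ring.truncate R) I J"
    by (auto elim: ideal_prod.induct)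
qed

lemma noetherian_cring_truncate:
  assumes "noetherian_cring R"
  shows "noetherian_cring (ring.truncate R)"
proof -
  have R: "cring R" "ring R" "noetherian_ring R"
    using assms by (auto simp: noetherian_cring_def cring_def)
  have "genideal (ring.truncate R) = genideal R"
    by (rule ext) (simp add: genideal_def ideal_truncate R(2))
  then show ?thesis
    using R ring_truncate[OF R(2)]
    by (simp add: noetherian_cring_def cring_truncate noetherian_ring_def noetherian_ring_axioms_def
        ideal_truncate)
qed

lemma maximal_collection_truncate:
  assumes "ring R"
  shows "maximal_collection (ring.truncate R) = maximal_collection R"
proof -
  have "ideals_prod (ring.truncate R) Is = ideals_prod R Is" for Is
    by (induct Is) (simp_all add: ideal_prod_truncate)
  then have "collection (ring.truncate R) = collection R"
    by (intro ext) (simp add: collection_def ideal_truncate assms)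
  then show ?thesis by (intro ext) (simp add: maximal_collection_def)
qed

theorem proposition4p6:
  shows "(\<forall>(A :: 'a ring) \<alpha>.
            noetherian_cring A \<and> ideal \<alpha> A \<and>
            finitely_many_maximal_collections (UP A) (poly_ideal A \<alpha>) \<longrightarrow>
            maximal_collections_extended A \<alpha>) \<and>
         (all_noetherian_finitely_many TYPE(nat \<Rightarrow> 'a) \<longrightarrow>
            (\<forall>(A :: 'a ring) \<alpha>.
               noetherian_cring A \<and> ideal \<alpha> A \<longrightarrow> maximal_collections_extended A \<alpha>))"
proof (intro conjI allI impI)
  fix A :: "'a ring" and \<alpha>
  assume "noetherian_cring A \<and> ideal \<alpha> A \<and>
    finitely_many_maximal_collections (UP A) (poly_ideal A \<alpha>)"
  then show "maximal_collections_extended A \<alpha>"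
    by (intro UP_cring.maximal_collections_extended_UP)
      (auto simp: UP_cring_def noetherian_cring_def finitely_many_maximal_collections_def)
next
  fix A :: "'a ring" and \<alpha>
  assume all: "all_noetherian_finitely_many TYPE(nat \<Rightarrow> 'a)"
    and A: "noetherian_cring A \<and> ideal \<alpha> A"
  then interpret UP_cring A "UP A"
    by (simp add: UP_cring_def noetherian_cring_def)
  have "noetherian_cring (UP A)"
    using A noetherian_UP P.cring_axioms by (simp add: noetherian_cring_def)
  moreover have "ideal (poly_ideal A \<alpha>) (ring.truncate (UP A))"
    using A by (simp add: ideal_truncate P.ring_axioms poly_ideal_ideal)
  \<comment> \<open>The assumption is applied to one ideal only, \<alpha>[x] in the plain record of
    \<open>UP A\<close>.\<close>
  ultimately have "finitely_many_maximal_collections (ring.truncate (UP A)) (poly_ideal A \<alpha>)"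
    using all noetherian_cring_truncate unfolding all_noetherian_finitely_many_def by blast
  then have "finite {M. maximal_collection (UP A) (poly_ideal A \<alpha>) M}"
    by (simp add: finitely_many_maximal_collections_def maximal_collection_truncate P.ring_axioms)
  then show "maximal_collections_extended A \<alpha>"
    using A by (intro maximal_collections_extended_UP) (auto simp: noetherian_cring_def)
qed

end
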